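(* Let $\mathcal{N}\subseteq\mathbb{V}^{m\times n}$ be a nonempty open set, let $g:\mathbb{R}^m\to\mathbb{R}^m$ be absolutely symmetric on an open set $\hat\sigma_{\mathcal{N}}\subseteq\mathbb{R}^m$ containing $\{\sigma(X)\mid X\in\mathcal{N}\}$, and let $G:\mathcal{N}\to\mathbb{V}^{m\times n}$ be the spectral operator with respect to $g$. Let $\overline{X}\in\mathcal{N}$ have the singular value decomposition $\overline{X}=\overline{U}[\mathrm{Diag}(\sigma(\overline{X}))\quad 0]\overline{V}^{*}$ with $\overline{U}\in\mathbb{O}^m$, $\overline{V}=[\overline{V}_1\quad\overline{V}_2]\in\mathbb{O}^n$, $\overline{V}_1\in\mathbb{V}^{n\times m}$, $\overline{V}_2\in\mathbb{V}^{n\times(n-m)}$. Then $G$ is Fréchet differentiable at $\overline{X}$ if and only if $g$ is Fréchet differentiable at $\overline\sigma=\sigma(\overline{X})$. In that case, the derivative of $G$ at $\overline{X}$ is given, for all $H\in\mathbb{V}^{m\times n}$, by $$G'(\overline{X})H=\overline{U}\big[\overline{\mathcal{E}}_1\circ S(A)+\mathrm{Diag}\big(\overline{\mathcal{C}}\,\mathrm{diag}(S(A))\big)+\overline{\mathcal{E}}_2\circ T(A)\quad\ \overline{\mathcal{F}}\circ B\big]\overline{V}^{*},$$ where $A:=\overline{U}^{*}H\overline{V}_1$, $B:=\overline{U}^{*}H\overline{V}_2$, and $\overline{\mathcal{E}}_1,\overline{\mathcal{E}}_2,\overline{\mathcal{F}},\overline{\mathcal{C}}$ are the matrices defined in the 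context.
   Context: Fix $m\le n$. $\mathbb{V}^{p\times q}$ denotes $\mathbb{R}^{p\times q}$ or $\mathbb{C}^{p\times q}$ (the field is fixed), viewed as a real Euclidean space with inner product $\mathrm{Re}(\mathrm{trace}(X^{*}Y))$, $X^{*}$ being the (conjugate) transpose; differentiability is over $\mathbb{R}$. $\mathbb{O}^p$ is the set of orthogonal (real case) or unitary (complex case) $p\times p$ matrices. $\sigma(Z)\in\mathbb{R}^m$ is the vector of singular values of $Z\in\mathbb{V}^{m\times n}$ in non-increasing order. $\mathrm{Diag}(x)$ is the diagonal matrix with diagonal $x$ and $\mathrm{diag}(Y)$ the vector of diagonal entries of a square matrix $Y$. $\circ$ is the entrywise (Hadamard) product; $S(Y):=\frac12(Y+Y^{*})$ and $T(Y):=\frac12(Y-Y^{*})$ for square $Y$. A signed permutation matrix has exactly one nonzero entry in each row and column, that entry being $\pm1$. $g$ is absolutely symmetric on $D$ if $g(Qx)=Qg(x)$ for all $x\in D$ and all $m\times m$ signed permutation matrices $Q$. The spectral operator is $G(X)=U[\mathrm{Diag}(g(\sigma(X)))\quad 0]V^{*}$, $X\in\mathcal{N}$, for any $(U,V)\in\mathbb{O}^m\times\mathbb{O}^n$ with $X=U[\mathrm{Diag}(\sigma(X))\quad 0]V^{*}$ (independent of the choice). When $g$ is Fréchet differentiable at $\overline\sigma$ with Jacobian $g'(\overline\sigma)\in\mathbb{R}^{m\times m}$, define $\overline\eta\in\mathbb{R}^m$ by $$\overline\eta_i:=\begin{cases}(g'(\overline\sigma))_{ii}-(g'(\overline\sigma))_{ij}&\text{if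 there is } j\ne i \text{ with }\overline\sigma_i=\overline\sigma_j,\\(g'(\overline\sigma))_{ii}&\text{otherwise,}\end{cases}$$ where in the first case $j$ is any such index (by absolute symmetry the value does not depend on $j$). Define $\overline{\mathcal{E}}_1,\overline{\mathcal{E}}_2,\overline{\mathcal{C}}\in\mathbb{R}^{m\times m}$ and $\overline{\mathcal{F}}\in\mathbb{R}^{m\times(n-m)}$ by $$(\overline{\mathcal{E}}_1)_{ij}:=\begin{cases}\dfrac{g_i(\overline\sigma)-g_j(\overline\sigma)}{\overline\sigma_i-\overline\sigma_j}&\overline\sigma_i\ne\overline\sigma_j,\\ \overline\eta_i&\text{otherwise,}\end{cases}\qquad(\overline{\mathcal{E}}_2)_{ij}:=\begin{cases}\dfrac{g_i(\overline\sigma)+g_j(\overline\sigma)}{\overline\sigma_i+\overline\sigma_j}&\overline\sigma_i+\overline\sigma_j\ne0,\\(g'(\overline\sigma))_{ii}&\text{otherwise,}\end{cases}$$ $$(\overline{\mathcal{F}})_{ij}:=\begin{cases}\dfrac{g_i(\overline\sigma)}{\overline\sigma_i}&\overline\sigma_i\ne0,\\(g'(\overline\sigma))_{ii}&\text{otherwise,}\end{cases}\qquad\overline{\mathcal{C}}:=g'(\overline\sigma)-\mathrm{Diag}(\overline\eta).$$ *)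

theory Defs
  imports "HOL-Analysis.Analysis"
begin

text \<open>
  The scalar field is a type of class \<open>real_or_complex\<close>: a finite-dimensional real normed field
  with an involution satisfying \<open>x * x\<^sup>* = |x|\<^sup>2\<close>. Its instances are \<^typ>\<open>real\<close> (with the identity)
  and \<^typ>\<open>complex\<close> (with \<^const>\<open>cnj\<close>); lemma \<open>real_or_complex_cases\<close> below shows that, up to
  isomorphism, there are no others.
\<close>

class real_or_complex = real_normed_field + euclidean_space +
  fixes conjugate :: "'a \<Rightarrow> 'a"
  assumes conjugate_add: "conjugate (x + y) = conjugate x + conjugate y"
    and conjugate_mult: "conjugate (x * y) = conjugate x * conjugate y"
    and conjugate_conjugate [simp]: "conjugate (conjugate x) = x"
    and mult_conjugate_scaleR: "x * conjugate x = ((norm x)\<^sup>2) *\<^sub>R 1"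

instantiation real :: real_or_complex
begin
definition conjugate_real :: "real \<Rightarrow> real" where "conjugate_real x = x"
instance by standard (simp_all add: conjugate_real_def power2_eq_square)
end

instantiation complex :: real_or_complex
begin
definition conjugate_complex :: "complex \<Rightarrow> complex" where "conjugate_complex = cnj"
instance by standard (simp_all add: conjugate_complex_def complex_mult_cnj cmod_def complex_eq_iff)
end

lemma mult_conjugate: "x * conjugate x = of_real ((norm (x::'a::real_or_complex))\<^sup>2)"
  by (simp add: mult_conjugate_scaleR of_real_def)

lemma conjugate_0 [simp]: "conjugate (0::'a::real_or_complex) = 0"
  using conjugate_add[of 0 "0::'a"] by simp

lemma conjugate_minus: "conjugate (- x) = - conjugate (x::'a::real_or_complex)"
  using conjugate_add[of x "- x"] by (simp add: eq_neg_iff_add_eq_0 add.commute)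

lemma conjugate_diff: "conjugate (x - y) = conjugate x - conjugate (y::'a::real_or_complex)"
  using conjugate_add[of x "- y"] by (simp add: conjugate_minus)

lemma conjugate_of_real [simp]: "conjugate (of_real r :: 'a::real_or_complex) = of_real r"
proof (cases "r = 0")
  case False
  have "(of_real r :: 'a) * conjugate (of_real r) = of_real r * of_real r"
    by (simp add: mult_conjugate power2_eq_square)
  then show ?thesis using False by simp
qed simp

lemma conjugate_sum: "conjugate (sum f A) = (\<Sum>x\<in>A. conjugate (f x :: 'a::real_or_complex))"
  by (induction A rule: infinite_finite_induct) (auto simp: conjugate_add)

lemma conjugate_eq_self_iff: "conjugate x = x \<longleftrightarrow> (x::'a::real_or_complex) \<in> \<real>"
proof
  assume "conjugate x = x"
  then have "x * x = of_real (norm x) * of_real (norm x)"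
    using mult_conjugate[of x] by (simp add: power2_eq_square)
  then have "x = of_real (norm x) \<or> x = - of_real (norm x)"
    by (simp add: square_eq_iff)
  then show "x \<in> \<real>" by (metis Reals_minus Reals_of_real)
qed (auto elim: Reals_cases)

lemma real_or_complex_cases:
  "(\<forall>x::'a::real_or_complex. x \<in> \<real>) \<or>
   (\<exists>i::'a. i * i = -1 \<and> conjugate i = - i \<and> (\<forall>x. \<exists>a b. x = of_real a + of_real b * i))"
proof (rule disjCI)
  assume "\<not> (\<exists>i::'a. i * i = -1 \<and> conjugate i = - i \<and> (\<forall>x. \<exists>a b. x = of_real a + of_real b * i))"
  then have no: "\<exists>x. \<forall>a b. x \<noteq> of_real a + of_real b * i"
    if "i * i = -1" "conjugate i = - i" for i :: 'a using that by blast
  show "\<forall>x::'a. x \<in> \<real>"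
  proof (rule ccontr)
    assume "\<not> (\<forall>x::'a. x \<in> \<real>)"
    then obtain y :: 'a where y: "conjugate y \<noteq> y" by (auto simp: conjugate_eq_self_iff)
    define z where "z = y - conjugate y"
    have z: "z \<noteq> 0" "conjugate z = - z" using y by (auto simp: z_def conjugate_diff)
    define i where "i = z / of_real (norm z)"
    have zi: "z = i * of_real (norm z)" using z by (simp add: i_def)
    then have "conjugate i * of_real (norm z) = - i * of_real (norm z)"
      using z(2) by (metis conjugate_mult conjugate_of_real mult_minus_left)
    then have "conjugate i * of_real (norm z) = (- i) * of_real (norm z)" by simp
    then have ci: "conjugate i = - i" using z(1) by (metis mult_right_cancel norm_eq_zero of_real_eq_0_iff)
    have "norm i = 1" using z by (simp add: i_def norm_divide)
    then have ii: "i * i = -1" using mult_conjugate[of i] ci by (simp add: minus_equation_iff)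
    have "\<exists>a b. x = of_real a + of_real b * i" for x :: 'a
    proof -
      have "conjugate (x + conjugate x) = x + conjugate x" by (simp add: conjugate_add add.commute)
      then obtain a where a: "x + conjugate x = of_real a"
        by (auto simp: conjugate_eq_self_iff elim: Reals_cases)
      have "conjugate ((x - conjugate x) * i) = (x - conjugate x) * i"
        by (simp add: conjugate_diff conjugate_mult ci algebra_simps)
      then obtain b where b: "(x - conjugate x) * i = of_real b"
        by (auto simp: conjugate_eq_self_iff elim: Reals_cases)
      have "(x - conjugate x) * (i * i) = of_real b * i" using b by (simp add: mult.assoc[symmetric])
      then have "conjugate x - x = of_real b * i" using ii by simp
      then have "x - conjugate x = - of_real b * i" by (metis minus_diff_eq mult_minus_left)
      then have "2 * x = of_real a - of_real b * i"
        using a by (metis (no_types, lifting) add_diff_cancel_left' add_diff_eq diff_add_cancel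
            diff_add_eq diff_diff_eq2 minus_mult_left mult_2 uminus_add_conv_diff add.commute)
      then have "x = (of_real a - of_real b * i) / 2" by (simp add: eq_divide_eq mult.commute)
      also have "\<dots> = of_real (a/2) + of_real (- b/2) * i" by (simp add: field_simps)
      finally show ?thesis by blast
    qed
    then show False using no[OF ii ci] by metis
  qed
qed


section \<open>Matrices\<close>

text \<open>
  A \<open>p \<times> q\<close> matrix has type \<^typ>\<open>'a^'q^'p\<close>. The index types carry a linear order, so that vectors
  can be sorted and the first \<open>m = CARD('m)\<close> columns of an \<open>n\<close>-column matrix, \<open>n = CARD('n)\<close>, make
  sense. The inner product on this type is the entrywise one, which is \<open>Re (trace (X\<^sup>* Y))\<close>; see
  \<open>of_real_inner_matrix\<close>.
\<close>

definition adj :: "'a::real_or_complex^'q^'p \<Rightarrow> 'a^'p^'q" where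
  "adj X = map_matrix conjugate (transpose X)"

definition unitary_mats :: "('a::real_or_complex^'p^'p) set" where
  "unitary_mats = {U. adj U ** U = mat 1 \<and> U ** adj U = mat 1}"

definition Diag_mat :: "'a::zero^'m \<Rightarrow> 'a^'m^'m" where
  "Diag_mat x = (\<chi> i j. if i = j then x $ i else 0)"

definition diag_vec :: "'a^'m^'m \<Rightarrow> 'a^'m" where
  "diag_vec Y = (\<chi> i. Y $ i $ i)"

definition real_Diag :: "real^'m \<Rightarrow> 'a::real_or_complex^'m^'m" where
  "real_Diag x = map_matrix of_real (Diag_mat x)"

definition hadamard :: "real^'q^'p \<Rightarrow> 'a::real_or_complex^'q^'p \<Rightarrow> 'a^'q^'p"  (infixl "\<odot>" 72) where
  "E \<odot> Y = (\<chi> i j. of_real (E $ i $ j) * Y $ i $ j)"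

definition S_part :: "'a::real_or_complex^'p^'p \<Rightarrow> 'a^'p^'p" where
  "S_part Y = (1/2) *\<^sub>R (Y + adj Y)"

definition T_part :: "'a::real_or_complex^'p^'p \<Rightarrow> 'a^'p^'p" where
  "T_part Y = (1/2) *\<^sub>R (Y - adj Y)"

text \<open>The order embedding of \<open>'m\<close> onto the first \<open>CARD('m)\<close> elements of \<open>'n\<close>
  (for \<open>CARD('m) \<le> CARD('n)\<close>).\<close>

definition lead :: "'m::{finite,linorder} \<Rightarrow> 'n::{finite,linorder}" where
  "lead i = (THE j. card {..<j} = card {..<i})"

text \<open>
  The block matrix \<open>[P  Q]\<close>. As there is no type with \<open>n - m\<close> elements (it may have to be empty), the
  block \<open>Q\<close> is stored in a matrix with \<open>n\<close> columns, in which the columns \<open>m+1, \<dots>, n\<close> are those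
  of \<open>Q\<close>, and the first \<open>m\<close> columns are irrelevant.
\<close>

definition blocks ::
  "'a^'m::{finite,linorder}^'p \<Rightarrow> 'a^'n::{finite,linorder}^'p \<Rightarrow> 'a^'n::_^'p" where
  "blocks P Q = (\<chi> i j. if j \<in> range (lead :: 'm \<Rightarrow> 'n) then P $ i $ (THE k. lead k = j) else Q $ i $ j)"


section \<open>Singular values and spectral operators\<close>

definition is_svd :: "'a::real_or_complex^'n::{finite,linorder}^'m::{finite,linorder} \<Rightarrow>
    'a^'m::_^'m::_ \<Rightarrow> real^'m::_ \<Rightarrow> 'a^'n::_^'n::_ \<Rightarrow> bool" where
  "is_svd X U s V \<longleftrightarrow> U \<in> unitary_mats \<and> V \<in> unitary_mats \<and> X = U ** blocks (real_Diag s) 0 ** adj V"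

text \<open>By the existence of the SVD and the uniqueness of singular values, the description determines
  \<open>s\<close> whenever \<open>CARD('m) \<le> CARD('n)\<close>.\<close>

definition singular_values :: "'a::real_or_complex^'n::{finite,linorder}^'m::{finite,linorder} \<Rightarrow> real^'m::_" where
  "singular_values X = (THE s. (\<forall>i. 0 \<le> s $ i) \<and> (\<forall>i j. i \<le> j \<longrightarrow> s $ j \<le> s $ i) \<and>
      (\<exists>U V. is_svd X U s V))"

definition signed_permutation_matrix :: "real^'m^'m \<Rightarrow> bool" where
  "signed_permutation_matrix Q \<longleftrightarrow>
     (\<forall>i. \<exists>!j. Q $ i $ j \<noteq> 0) \<and> (\<forall>j. \<exists>!i. Q $ i $ j \<noteq> 0) \<and>
     (\<forall>i j. Q $ i $ j \<noteq> 0 \<longrightarrow> Q $ i $ j = 1 \<or> Q $ i $ j = -1)"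

definition absolutely_symmetric_on :: "(real^'m) set \<Rightarrow> (real^'m \<Rightarrow> real^'m) \<Rightarrow> bool" where
  "absolutely_symmetric_on D g \<longleftrightarrow>
     (\<forall>x\<in>D. \<forall>Q. signed_permutation_matrix Q \<longrightarrow> g (Q *v x) = Q *v g x)"

text \<open>The choice of \<open>(U, V)\<close> is immaterial if \<open>g\<close> is absolutely symmetric at \<open>singular_values X\<close>;
  see \<open>spectral_value_unique\<close> and \<open>spectral_operator_eq\<close>.\<close>

definition spectral_operator :: "(real^'m::_ \<Rightarrow> real^'m::_) \<Rightarrow>
    'a::real_or_complex^'n::{finite,linorder}^'m::{finite,linorder} \<Rightarrow> 'a^'n::_^'m::_" where
  "spectral_operator g X =
     (case SOME (U, V). is_svd X U (singular_values X) V of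
        (U, V) \<Rightarrow> U ** blocks (real_Diag (g (singular_values X))) 0 ** adj V)"


section \<open>The coefficient matrices of the derivative\<close>

definition eta :: "(real^'m \<Rightarrow> real^'m) \<Rightarrow> real^'m \<Rightarrow> real^'m" where
  "eta g s = (\<chi> i. let J = jacobian g (at s) in
     if \<exists>j. j \<noteq> i \<and> s $ i = s $ j
     then J $ i $ i - J $ i $ (SOME j. j \<noteq> i \<and> s $ i = s $ j)
     else J $ i $ i)"

definition E1_mat :: "(real^'m \<Rightarrow> real^'m) \<Rightarrow> real^'m \<Rightarrow> real^'m^'m" where
  "E1_mat g s = (\<chi> i j. if s $ i \<noteq> s $ j then (g s $ i - g s $ j) / (s $ i - s $ j) else eta g s $ i)"

definition E2_mat :: "(real^'m \<Rightarrow> real^'m) \<Rightarrow> real^'m \<Rightarrow> real^'m^'m" where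
  "E2_mat g s = (\<chi> i j. if s $ i + s $ j \<noteq> 0 then (g s $ i + g s $ j) / (s $ i + s $ j)
     else jacobian g (at s) $ i $ i)"

text \<open>Stored with \<open>n\<close> columns, to be used as second argument of \<^const>\<open>blocks\<close>; the entries do not
  depend on the column.\<close>

definition F_mat :: "(real^'m \<Rightarrow> real^'m) \<Rightarrow> real^'m \<Rightarrow> real^'n^'m" where
  "F_mat g s = (\<chi> i j. if s $ i \<noteq> 0 then g s $ i / s $ i else jacobian g (at s) $ i $ i)"

definition C_mat :: "(real^'m \<Rightarrow> real^'m) \<Rightarrow> real^'m \<Rightarrow> real^'m^'m" where
  "C_mat g s = jacobian g (at s) - Diag_mat (eta g s)"


section \<open>Basic facts: inner product, leading columns, well-definedness of spectral operators\<close>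

lemma of_real_inner_scalar:
  "of_real (x \<bullet> y) = (conjugate x * y + conjugate (conjugate x * y)) / (2::'a::real_or_complex)"
proof -
  have "of_real ((norm (x + y))\<^sup>2 - (norm x)\<^sup>2 - (norm y)\<^sup>2) = x * conjugate y + y * conjugate x"
    unfolding of_real_diff mult_conjugate[symmetric] by (simp add: conjugate_add algebra_simps)
  moreover have "(norm (x + y))\<^sup>2 - (norm x)\<^sup>2 - (norm y)\<^sup>2 = 2 * (x \<bullet> y)"
    by (simp add: power2_norm_eq_inner inner_add_left inner_add_right inner_commute)
  ultimately show ?thesis by (simp add: conjugate_mult mult.commute)
qed

lemma of_real_inner_matrix:
  fixes X Y :: "'a::real_or_complex^'q^'p"
  shows "of_real (X \<bullet> Y) = (trace (adj X ** Y) + conjugate (trace (adj X ** Y))) / 2"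
proof -
  have "trace (adj X ** Y) = (\<Sum>j\<in>UNIV. \<Sum>i\<in>UNIV. conjugate (X $ i $ j) * Y $ i $ j)"
    by (simp add: trace_def matrix_matrix_mult_def adj_def transpose_def)
  also have "\<dots> = (\<Sum>i\<in>UNIV. \<Sum>j\<in>UNIV. conjugate (X $ i $ j) * Y $ i $ j)"
    by (rule sum.swap)
  finally have tr: "trace (adj X ** Y) = (\<Sum>i\<in>UNIV. \<Sum>j\<in>UNIV. conjugate (X $ i $ j) * Y $ i $ j)" .
  have "of_real (X \<bullet> Y) = (\<Sum>i\<in>UNIV. \<Sum>j\<in>UNIV. of_real (X $ i $ j \<bullet> Y $ i $ j) :: 'a)"
    by (simp add: inner_vec_def)
  also have "\<dots> = (trace (adj X ** Y) + conjugate (trace (adj X ** Y))) / 2"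
    unfolding tr of_real_inner_scalar
    by (simp add: conjugate_sum sum.distrib sum_divide_distrib[symmetric])
  finally show ?thesis .
qed

lemma card_lessThan_strict_mono:
  "strict_mono (\<lambda>j::'n::{finite,linorder}. card {..<j})"
  by (rule strict_monoI) (auto intro!: psubset_card_mono)

lemma range_card_lessThan:
  "range (\<lambda>j::'n::{finite,linorder}. card {..<j}) = {..<CARD('n)}"
proof (rule card_subset_eq)
  show "range (\<lambda>j::'n. card {..<j}) \<subseteq> {..<CARD('n)}"
    by (auto intro!: psubset_card_mono)
  show "card (range (\<lambda>j::'n. card {..<j})) = card {..<CARD('n)}"
    by (simp add: card_image strict_mono_imp_inj_on card_lessThan_strict_mono)
qed simp

lemma card_lead:
  fixes i :: "'m::{finite,linorder}"
  assumes "CARD('m) \<le> CARD('n::{finite,linorder})"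
  shows "card {..<lead i :: 'n} = card {..<i}"
proof -
  have "card {..<i} \<in> {..<CARD('m)}" using range_card_lessThan[where 'n='m] by blast
  then have "card {..<i} \<in> range (\<lambda>j::'n. card {..<j})"
    using assms range_card_lessThan[where 'n='n] by auto
  then obtain j :: 'n where j: "card {..<j} = card {..<i}" by auto
  have "k = j" if "card {..<k} = card {..<i}" for k :: 'n
    using that j by (intro injD[OF strict_mono_imp_inj_on[OF card_lessThan_strict_mono]]) simp
  with j have "\<exists>!j::'n. card {..<j} = card {..<i}" by blast
  from theI'[OF this] show ?thesis by (simp add: lead_def)
qed

lemma strict_mono_lead:
  assumes "CARD('m::{finite,linorder}) \<le> CARD('n::{finite,linorder})"
  shows "strict_mono (lead :: 'm \<Rightarrow> 'n)"
  by (metis (mono_tags, lifting) assms card_lead card_lessThan_strict_mono strict_mono_def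
      strict_mono_less)

lemma inj_lead:
  assumes "CARD('m::{finite,linorder}) \<le> CARD('n::{finite,linorder})"
  shows "inj (lead :: 'm \<Rightarrow> 'n)"
  using strict_mono_lead[OF assms] by (rule strict_mono_imp_inj_on)

lemma blocks_lead:
  assumes "CARD('m::{finite,linorder}) \<le> CARD('n::{finite,linorder})"
  shows "blocks P Q $ i $ (lead (k::'m) :: 'n) = P $ i $ k"
proof -
  have "(THE l. (lead l :: 'n) = lead k) = k"
    by (rule the_equality) (auto dest: injD[OF inj_lead[OF assms]])
  then show ?thesis by (simp add: blocks_def)
qed

lemma blocks_not_lead: "j \<notin> range (lead :: 'm \<Rightarrow> 'n) \<Longrightarrow>
    blocks (P :: 'a^'m::{finite,linorder}^'p) Q $ i $ (j::'n::{finite,linorder}) = Q $ i $ j"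
  by (simp add: blocks_def)

lemma absolutely_symmetric_component:
  fixes g :: "real^'m \<Rightarrow> real^'m"
  assumes g: "absolutely_symmetric_on {s} g" and e: "e = 1 \<or> e = -1" and ij: "s $ i = e * s $ j"
  shows "g s $ i = e * g s $ j"
proof -
  define t where "t = Transposition.transpose i j"
  define c where "c a = (if a = i \<or> a = j then e else 1)" for a
  define Q :: "real^'m^'m" where "Q = (\<chi> a b. if b = t a then c a else 0)"
  have Q: "(Q *v x) $ a = c a * x $ t a" for x a
    by (simp add: Q_def matrix_vector_mult_def if_distrib[of "\<lambda>u. u * _"] cong: if_cong)
  have c: "c a = 1 \<or> c a = -1" for a using e by (auto simp: c_def)
  have tt: "t (t a) = a" for a by (simp add: t_def)
  have c0: "c a \<noteq> 0" for a using c[of a] by auto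
  have "\<exists>!a. b = t a" for b
    by (rule ex1I[of _ "t b"]) (simp_all add: tt)
  then have "signed_permutation_matrix Q"
    unfolding signed_permutation_matrix_def using c by (simp add: Q_def c0)
  then have "g (Q *v s) = Q *v g s" using g by (auto simp: absolutely_symmetric_on_def)
  moreover have "Q *v s = s"
  proof -
    have "e * e = 1" using e by auto
    then have ji: "e * s $ i = s $ j" unfolding ij by (simp add: mult.assoc[symmetric])
    have "c a * s $ t a = s $ a" for a
      unfolding c_def t_def Transposition.transpose_def using ji ij[symmetric] by (simp only: if_distrib) simp
    then show ?thesis by (simp add: vec_eq_iff Q)
  qed
  ultimately have "g s = Q *v g s" by simp
  then have "g s $ i = (Q *v g s) $ i" by (rule arg_cong)
  then have "g s $ i = c i * g s $ t i" unfolding Q .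
  then show ?thesis by (simp add: c_def t_def)
qed

lemma adj_matrix_mult:
  fixes A :: "'a::real_or_complex^'q^'p" and B :: "'a^'r^'q"
  shows "adj (A ** B) = adj B ** adj A"
  by (simp add: vec_eq_iff adj_def transpose_def matrix_matrix_mult_def conjugate_sum conjugate_mult
      mult.commute)

lemma adj_adj [simp]: "adj (adj A) = (A :: 'a::real_or_complex^'q^'p)"
  by (simp add: vec_eq_iff adj_def transpose_def)

lemma Diag_block_mult:
  fixes W :: "'a::real_or_complex^'q^'n::{finite,linorder}" and x :: "real^'m::{finite,linorder}"
  assumes "CARD('m) \<le> CARD('n)"
  shows "((blocks (real_Diag x) 0 :: 'a^'n::_^'m::_) ** W) $ i $ k = of_real (x $ i) * W $ lead i $ k"
proof -
  have "(blocks (real_Diag x) 0 :: 'a^'n::_^'m::_) $ i $ l = (if l = lead i then of_real (x $ i) else 0)" for l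
  proof (cases "l \<in> range (lead :: 'm \<Rightarrow> 'n)")
    case True
    then show ?thesis using inj_lead[OF assms]
      by (auto simp: blocks_lead[OF assms] real_Diag_def Diag_mat_def inj_def)
  qed (auto simp: blocks_not_lead)
  then show ?thesis
    by (simp add: matrix_matrix_mult_def if_distrib[of "\<lambda>u. u * _"] cong: if_cong)
qed

lemma mult_Diag_block:
  fixes P :: "'a::real_or_complex^'m::{finite,linorder}^'p" and x :: "real^'m::_"
  assumes "CARD('m) \<le> CARD('n::{finite,linorder})"
  shows "(P ** (blocks (real_Diag x) 0 :: 'a^'n::_^'m::_)) $ i $ lead k = P $ i $ k * of_real (x $ k)"
    and "l \<notin> range (lead :: 'm \<Rightarrow> 'n) \<Longrightarrow> (P ** (blocks (real_Diag x) 0 :: 'a^'n::_^'m::_)) $ i $ l = 0"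
  by (simp_all add: matrix_matrix_mult_def blocks_lead[OF assms] blocks_not_lead real_Diag_def
      Diag_mat_def if_distrib[of of_real] if_distrib[of "\<lambda>u. _ * u"] cong: if_cong)

lemma spectral_value_unique:
  fixes X :: "'a::real_or_complex^'n::{finite,linorder}^'m::{finite,linorder}"
  assumes mn: "CARD('m) \<le> CARD('n)" and g: "absolutely_symmetric_on {s} g"
    and svd: "is_svd X U s V" "is_svd X U' s V'"
  shows "U ** blocks (real_Diag (g s)) 0 ** adj V = U' ** blocks (real_Diag (g s)) 0 ** adj V'"
proof -
  let ?D = "blocks (real_Diag s) 0 :: 'a^'n::_^'m::_" and ?E = "blocks (real_Diag (g s)) 0 :: 'a^'n::_^'m::_"
  define P where "P = adj U' ** U"
  define W where "W = adj V' ** V"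
  have un: "adj U ** U = mat 1" "U ** adj U = mat 1" "adj V ** V = mat 1" "V ** adj V = mat 1"
    "adj U' ** U' = mat 1" "U' ** adj U' = mat 1" "adj V' ** V' = mat 1" "V' ** adj V' = mat 1"
    and X: "U ** ?D ** adj V = U' ** ?D ** adj V'"
    using svd by (auto simp: is_svd_def unitary_mats_def)
  have "P ** ?D = adj U' ** (U ** ?D ** adj V) ** V"
    by (simp add: P_def matrix_mul_assoc[symmetric] un)
  also have "\<dots> = (adj U' ** U') ** ?D ** W"
    unfolding X by (simp add: W_def matrix_mul_assoc)
  finally have 1: "P ** ?D = ?D ** W" by (simp add: un)
  have "adj P ** ?D = adj U ** (U' ** ?D ** adj V') ** V'"
    by (simp add: P_def adj_matrix_mult matrix_mul_assoc[symmetric] un)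
  also have "\<dots> = (adj U ** U) ** ?D ** adj W"
    unfolding X[symmetric] by (simp add: W_def adj_matrix_mult matrix_mul_assoc)
  finally have 2: "adj P ** ?D = ?D ** adj W" by (simp add: un)
  have a: "P $ i $ j * of_real (s $ j) = of_real (s $ i) * W $ lead i $ lead j" for i j
    using arg_cong[OF 1, of "\<lambda>M. M $ i $ lead j"]
    by (simp add: mult_Diag_block[OF mn] Diag_block_mult[OF mn])
  have b: "P $ i $ j * of_real (s $ i) = of_real (s $ j) * W $ lead i $ lead j" for i j
  proof -
    have "conjugate (P $ i $ j) * of_real (s $ i) = of_real (s $ j) * conjugate (W $ lead i $ lead j)"
      using arg_cong[OF 2, of "\<lambda>M. M $ j $ lead i"]
      by (simp add: mult_Diag_block[OF mn] Diag_block_mult[OF mn] adj_def transpose_def)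
    from arg_cong[OF this, of conjugate] show ?thesis by (simp add: conjugate_mult)
  qed
  have zero: "g s $ i = 0" if "s $ i = 0" for i
    using absolutely_symmetric_component[OF g, of "-1" i i] that by simp
  have "P ** ?E = ?E ** W"
  proof -
    have "(P ** ?E) $ i $ k = (?E ** W) $ i $ k" for i k
    proof (cases "k \<in> range (lead :: 'm \<Rightarrow> 'n)")
      case True
      then obtain j :: 'm where k: "k = lead j" by auto
      let ?p = "P $ i $ j" and ?w = "W $ lead i $ lead j"
      have "?p * of_real (g s $ j) = of_real (g s $ i) * ?w"
      proof -
        consider "s $ i = 0" "s $ j = 0" | "s $ i = s $ j" "s $ j \<noteq> 0" | "s $ i = - s $ j" "s $ j \<noteq> 0"
          | "(s $ i)\<^sup>2 \<noteq> (s $ j)\<^sup>2" by (force simp: power2_eq_iff)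
        then show ?thesis
        proof cases
          case 1
          then show ?thesis by (simp add: zero)
        next
          case 2
          then show ?thesis
            using a[of i j] absolutely_symmetric_component[OF g, of 1 i j] by (simp add: mult.commute)
        next
          case 3
          have "of_real (s $ j) * ?p = of_real (s $ j) * (- ?w)"
            using a[of i j] unfolding 3(1) by (simp add: mult.commute)
          then have "?p = - ?w" using 3(2) by (metis mult_left_cancel of_real_eq_0_iff)
          then show ?thesis
            using absolutely_symmetric_component[OF g, of "-1" i j] 3(1) by simp
        next
          case 4
          have "?p * (of_real (s $ j) * of_real (s $ j)) = of_real (s $ i) * (of_real (s $ j) * ?w)"
            unfolding mult.assoc[symmetric] a by (simp only: mult_ac)
          also have "\<dots> = ?p * (of_real (s $ i) * of_real (s $ i))"
            unfolding b[symmetric] by (simp only: mult_ac)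
          finally have "?p * of_real ((s $ i)\<^sup>2 - (s $ j)\<^sup>2) = 0"
            by (auto simp: power2_eq_square right_diff_distrib)
          then have p: "?p = 0" using 4 by (simp only: mult_eq_0_iff of_real_eq_0_iff right_minus_eq simp_thms)
          moreover have "?w = 0"
          proof -
            have "s $ i \<noteq> 0 \<or> s $ j \<noteq> 0" using 4 by auto
            then show ?thesis using a[of i j] b[of i j] unfolding p by auto
          qed
          ultimately show ?thesis by simp
        qed
      qed
      then show ?thesis by (simp add: k mult_Diag_block[OF mn] Diag_block_mult[OF mn])
    next
      case False
      have "of_real (s $ i) * W $ lead i $ k = 0"
        using arg_cong[OF 1, of "\<lambda>M. M $ i $ k"] False
        by (simp add: mult_Diag_block[OF mn] Diag_block_mult[OF mn])
      then show ?thesis using False zero[of i]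
        by (auto simp: mult_Diag_block[OF mn] Diag_block_mult[OF mn])
    qed
    then show ?thesis by (simp add: vec_eq_iff)
  qed
  then have "U' ** (P ** ?E) ** adj V = U' ** (?E ** W) ** adj V" by simp
  moreover have "U' ** (P ** ?E) ** adj V = U ** ?E ** adj V"
    by (simp add: P_def matrix_mul_assoc un)
  moreover have "U' ** (?E ** W) ** adj V = U' ** ?E ** adj V'"
    by (simp add: W_def matrix_mul_assoc[symmetric] un)
  ultimately show ?thesis by simp
qed

lemma spectral_operator_eq:
  fixes X :: "'a::real_or_complex^'n::{finite,linorder}^'m::{finite,linorder}"
  assumes "CARD('m) \<le> CARD('n)" and "absolutely_symmetric_on {singular_values X} g"
    and "is_svd X U (singular_values X) V"
  shows "spectral_operator g X = U ** blocks (real_Diag (g (singular_values X))) 0 ** adj V"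
proof -
  have "\<exists>UV. case UV of (U, V) \<Rightarrow> is_svd X U (singular_values X) V" using assms(3) by auto
  from someI_ex[OF this] show ?thesis
    using spectral_value_unique[OF assms(1,2) _ assms(3)]
    by (auto simp: spectral_operator_def split: prod.splits)
qed

end

theory Submission
  imports Defs
begin

text \<open>
  Write \<open>D\<^sub>x = [Diag x  0]\<close> and \<open>s = \<sigma>(X)\<close>, so that \<open>X = U D\<^sub>s V\<^sup>*\<close> and the spectral operator sends
  \<open>P D\<^sub>t W\<^sup>*\<close> to \<open>P D\<^bsub>g(t)\<^esub> W\<^sup>*\<close>.

  If \<open>G\<close> is differentiable at \<open>X\<close>, then so is \<open>g\<close> at \<open>s\<close>, because \<open>G (U D\<^sub>x V\<^sup>*) = U D\<^bsub>g(x)\<^esub> V\<^sup>*\<close> for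
  every \<open>x\<close> near \<open>s\<close>, sorted or not, by absolute symmetry (\<open>spectral_operator_rdiag\<close>).

  For the converse, to avoid perturbing the singular vectors of \<open>X\<close>, compare \<open>g\<close> with a
  model \<open>\<phi>\<close> that has the same value and the same derivative at \<open>s\<close>, and whose spectral operator \<open>\<Phi>\<close> is
  a polynomial in the entries of \<open>Y\<close> and \<open>Y\<^sup>*\<close>, hence differentiable everywhere. If \<open>t = \<sigma>(Y)\<close>, both
  \<open>G Y\<close> and \<open>\<Phi> Y\<close> are diagonal in the same frames, so that
  \<open>|G Y - \<Phi> Y| = |g(t) - \<phi>(t)| = o(|t - s|)\<close>, and \<open>|t - s| \<le> |Y - X|\<close> by Mirsky's inequality
  (\<open>singular_values_nonexpansive\<close>). Therefore \<open>G\<close> is differentiable at \<open>X\<close> with the derivative of \<open>\<Phi>\<close>.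

  The building blocks of the model are odd polynomials \<open>f(x) = x q(x\<^sup>2)\<close> acting by \<open>Y \<mapsto> Y q(Y\<^sup>* Y)\<close>. An
  induction along \<open>f \<mapsto> x\<^sup>2 f\<close> shows that the derivative of this map at \<open>D\<^sub>s\<close> is given by the divided
  differences of \<open>f\<close>, that is, by the matrices \<open>E\<^sub>1\<close>, \<open>E\<^sub>2\<close> and \<open>F\<close>
  (\<open>odd_poly_matrix\<close>). Differentiating the identity \<open>g(Q x) = Q g(x)\<close> for the \<open>Q\<close> that fix \<open>s\<close> shows that
  \<open>g'(s) = Diag \<eta> + C\<close>, where \<open>\<eta>\<close> depends on the value of \<open>s\<^sub>i\<close> only, and \<open>C\<^sub>i\<^sub>j\<close> on the values of
  \<open>s\<^sub>i\<close> and \<open>s\<^sub>j\<close> only, being zero if one of them is zero. So Hermite interpolation provides odd polynomials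
  \<open>p\<close> with \<open>p(s\<^sub>i) = g\<^sub>i(s)\<close> and \<open>p'(s\<^sub>i) = \<eta>\<^sub>i\<close>, \<open>r\<^sub>j\<close> with \<open>r\<^sub>j(s\<^sub>i) = C\<^sub>i\<^sub>j\<close>, and \<open>q\<^sub>j\<close>
  whose values at the \<open>s\<^sub>k\<close> are the indicator of one block of equal nonzero singular values. The model is
  \<open>\<phi>(x)\<^sub>i = p(x\<^sub>i) + \<Sum>\<^sub>j (\<tau>\<^sub>j(x) - \<tau>\<^sub>j(s)) r\<^sub>j(x\<^sub>i)\<close> with \<open>\<tau>\<^sub>j(x) = \<Sum>\<^sub>k x\<^sub>k q\<^sub>j(x\<^sub>k)\<close>:
  its first term produces \<open>Diag \<eta>\<close>, and the sum produces \<open>C\<close>. On matrices, \<open>\<tau>\<^sub>j\<close> becomes the inner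
  product of \<open>Y\<close> with \<open>q\<^sub>j(Y)\<close>.
\<close>

section \<open>Unitary matrices over the real or complex numbers\<close>

lemma conjugate_1 [simp]: "conjugate (1::'a::real_or_complex) = 1"
  using conjugate_of_real[of 1] by simp

lemma conjugate_scaleR [simp]: "conjugate (r *\<^sub>R x) = r *\<^sub>R conjugate (x::'a::real_or_complex)"
  by (simp add: scaleR_conv_of_real conjugate_mult)

lemma norm_conjugate [simp]: "norm (conjugate x) = norm (x::'a::real_or_complex)"
proof -
  have "of_real ((norm (conjugate x))\<^sup>2) = (of_real ((norm x)\<^sup>2) :: 'a)"
    unfolding mult_conjugate[symmetric] by (simp add: mult.commute)
  then show ?thesis unfolding of_real_eq_iff by simp
qed

text \<open>Multiplication by a scalar has multiplication by its conjugate as adjoint; this is what makes the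
  real inner product usable in place of the trace form.\<close>

lemma inner_mult_conjugate:
  fixes x y z :: "'a::real_or_complex"
  shows "(x * y) \<bullet> z = y \<bullet> (conjugate x * z)"
proof -
  have "(of_real ((x * y) \<bullet> z) :: 'a) = of_real (y \<bullet> (conjugate x * z))"
    unfolding of_real_inner_scalar by (simp add: conjugate_mult mult_ac)
  then show ?thesis by (simp only: of_real_eq_iff)
qed

lemma inner_conjugate_conjugate:
  "conjugate x \<bullet> conjugate y = x \<bullet> (y::'a::real_or_complex)"
proof -
  have "(of_real (conjugate x \<bullet> conjugate y) :: 'a) = of_real (x \<bullet> y)"
    unfolding of_real_inner_scalar by (simp add: conjugate_mult mult_ac add.commute)
  then show ?thesis by (simp only: of_real_eq_iff)
qed

lemma inner_1_1 [simp]: "(1::'a::real_or_complex) \<bullet> 1 = 1"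
  by (simp add: power2_norm_eq_inner[symmetric])

lemma adj_nth [simp]: "adj X $ i $ j = conjugate (X $ j $ i)"
  by (simp add: adj_def transpose_def)

lemma adj_mat_1 [simp]: "adj (mat 1) = (mat 1 :: 'a::real_or_complex^'p^'p)"
  by (simp add: vec_eq_iff mat_def)

lemma linear_adj: "linear (adj :: 'a::real_or_complex^'q^'p \<Rightarrow> 'a^'p^'q)"
  by (rule linearI) (simp_all add: vec_eq_iff conjugate_add)

lemma bounded_linear_adj: "bounded_linear (adj :: 'a::real_or_complex^'q^'p \<Rightarrow> 'a^'p^'q)"
  using linear_adj linear_conv_bounded_linear by blast

lemma bounded_bilinear_matrix_mult:
  "bounded_bilinear ((**) :: 'a::real_or_complex^'q^'p \<Rightarrow> 'a^'r^'q \<Rightarrow> 'a^'r^'p)"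
  unfolding bilinear_conv_bounded_bilinear[symmetric] bilinear_def
  by (auto intro!: linearI simp: vec_eq_iff matrix_matrix_mult_def algebra_simps sum.distrib
      scaleR_sum_right)

lemmas continuous_on_matrix_mult [continuous_intros] =
  bounded_bilinear.continuous_on[OF bounded_bilinear_matrix_mult]
lemmas continuous_on_adj [continuous_intros] =
  bounded_linear.continuous_on[OF bounded_linear_adj]
lemmas bounded_linear_matrix_mult_left =
  bounded_bilinear.bounded_linear_left[OF bounded_bilinear_matrix_mult]
lemmas bounded_linear_matrix_mult_right =
  bounded_bilinear.bounded_linear_right[OF bounded_bilinear_matrix_mult]

lemma unitary_matsI: "adj U ** U = mat 1 \<Longrightarrow> U ** adj U = mat 1 \<Longrightarrow> U \<in> unitary_mats"
  by (simp add: unitary_mats_def)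

lemma unitary_matsD:
  assumes "U \<in> unitary_mats"
  shows "adj U ** U = mat 1" and "U ** adj U = mat 1"
    and "adj U ** (U ** A) = A" and "U ** (adj U ** B) = B"
  using assms by (simp_all add: unitary_mats_def matrix_mul_assoc)

lemma unitary_mats_1: "mat 1 \<in> unitary_mats"
  by (simp add: unitary_mats_def)

lemma unitary_mats_adj: "U \<in> unitary_mats \<Longrightarrow> adj U \<in> unitary_mats"
  by (simp add: unitary_mats_def)

lemma unitary_mats_mult: "U \<in> unitary_mats \<Longrightarrow> V \<in> unitary_mats \<Longrightarrow> U ** V \<in> unitary_mats"
  by (rule unitary_matsI) (simp_all add: adj_matrix_mult unitary_matsD matrix_mul_assoc[symmetric])

lemma inner_matrix_mult_left:
  fixes U :: "'a::real_or_complex^'r^'p"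
  shows "(U ** X) \<bullet> Y = X \<bullet> (adj U ** Y)"
proof -
  have "(of_real ((U ** X) \<bullet> Y) :: 'a) = of_real (X \<bullet> (adj U ** Y))"
    unfolding of_real_inner_matrix by (simp add: adj_matrix_mult matrix_mul_assoc)
  then show ?thesis by (simp only: of_real_eq_iff)
qed

lemma inner_adj_adj: "adj X \<bullet> adj Y = X \<bullet> (Y :: 'a::real_or_complex^'q^'p)"
  unfolding inner_vec_def by (simp add: inner_conjugate_conjugate) (rule sum.swap)

lemma inner_matrix_mult_right:
  fixes V :: "'a::real_or_complex^'r^'p"
  shows "(X ** V) \<bullet> Y = X \<bullet> (Y ** adj V)"
proof -
  have "(X ** V) \<bullet> Y = (adj V ** adj X) \<bullet> adj Y"
    using inner_adj_adj[of "X ** V" Y] by (simp add: adj_matrix_mult)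
  also have "\<dots> = adj X \<bullet> adj (Y ** adj V)"
    by (simp add: inner_matrix_mult_left adj_matrix_mult)
  finally show ?thesis by (simp add: inner_adj_adj)
qed

lemma inner_unitary:
  assumes "U \<in> unitary_mats" "V \<in> unitary_mats"
  shows "(U ** X ** adj V) \<bullet> (U ** Y ** adj V) = X \<bullet> Y"
proof -
  have "(U ** X ** adj V) \<bullet> (U ** Y ** adj V) = (U ** X) \<bullet> (U ** Y)"
    unfolding inner_matrix_mult_right[of "U ** X" "adj V"]
    by (simp add: matrix_mul_assoc[symmetric] unitary_matsD[OF assms(2)])
  also have "\<dots> = X \<bullet> Y"
    by (simp add: inner_matrix_mult_left unitary_matsD[OF assms(1)])
  finally show ?thesis .
qed

lemma norm_unitary:
  assumes "U \<in> unitary_mats" "V \<in> unitary_mats"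
  shows "norm (U ** X ** adj V) = norm X"
  by (simp add: norm_eq_sqrt_inner inner_unitary[OF assms])

lemma unitary_row_sum:
  assumes "U \<in> (unitary_mats :: ('a::real_or_complex^'p^'p) set)"
  shows "(\<Sum>j\<in>UNIV. (norm (U $ i $ j))\<^sup>2) = 1"
proof -
  have "(of_real (\<Sum>j\<in>UNIV. (norm (U $ i $ j))\<^sup>2) :: 'a) = (U ** adj U) $ i $ i"
    by (simp add: matrix_matrix_mult_def mult_conjugate)
  also have "\<dots> = of_real 1" by (simp add: unitary_matsD(2)[OF assms] mat_def)
  finally show ?thesis by (simp only: of_real_eq_iff)
qed

lemma unitary_col_sum:
  assumes "U \<in> (unitary_mats :: ('a::real_or_complex^'p^'p) set)"
  shows "(\<Sum>i\<in>UNIV. (norm (U $ i $ j))\<^sup>2) = 1"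
  using unitary_row_sum[OF unitary_mats_adj[OF assms], of j] by simp

lemma compact_unitary_mats: "compact (unitary_mats :: ('a::real_or_complex^'p^'p) set)"
proof -
  have "norm U \<le> CARD('p)" if "U \<in> unitary_mats" for U :: "'a^'p^'p"
  proof -
    have "norm (U $ i) = 1" for i
      using unitary_row_sum[OF that, of i] by (simp add: norm_vec_def L2_set_def)
    then show ?thesis
      using L2_set_le_sum[of UNIV "\<lambda>i. norm (U $ i)"] by (simp add: norm_vec_def)
  qed
  then have "bounded (unitary_mats :: ('a^'p^'p) set)"
    by (auto simp: bounded_iff)
  moreover have "closed (unitary_mats :: ('a^'p^'p) set)"
    unfolding unitary_mats_def by (intro closed_Collect_conj closed_Collect_eq continuous_intros)
  ultimately show ?thesis by (simp add: compact_eq_bounded_closed)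
qed

section \<open>Rectangular diagonal matrices\<close>

abbreviation (input) rdiag :: "real^'m::{finite,linorder} \<Rightarrow> 'a::real_or_complex^'n::{finite,linorder}^'m::_"
  where "rdiag x \<equiv> blocks (real_Diag x) 0"

lemma rdiag_nth:
  fixes x :: "real^'m::{finite,linorder}"
  assumes "CARD('m) \<le> CARD('n::{finite,linorder})"
  shows "(rdiag x :: 'a::real_or_complex^'n::_^'m::_) $ i $ l = (if l = lead i then of_real (x $ i) else 0)"
proof (cases "l \<in> range (lead :: 'm \<Rightarrow> 'n)")
  case True
  then show ?thesis using inj_lead[OF assms]
    by (auto simp: blocks_lead[OF assms] real_Diag_def Diag_mat_def inj_def)
qed (auto simp: blocks_not_lead)

lemma inner_rdiag:
  fixes x :: "real^'m::{finite,linorder}"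
  assumes "CARD('m) \<le> CARD('n::{finite,linorder})"
  shows "(rdiag x :: 'a::real_or_complex^'n::_^'m::_) \<bullet> M = (\<Sum>i\<in>UNIV. x $ i * (1 \<bullet> M $ i $ lead i))"
proof -
  have "(rdiag x :: 'a^'n::_^'m::_) $ i $ l \<bullet> M $ i $ l = (if l = lead i then x $ i * (1 \<bullet> M $ i $ l) else 0)"
    for i l by (simp add: rdiag_nth[OF assms] of_real_def)
  then show ?thesis by (simp add: inner_vec_def)
qed

lemma inner_rdiag_rdiag:
  fixes x :: "real^'m::{finite,linorder}"
  assumes "CARD('m) \<le> CARD('n::{finite,linorder})"
  shows "(rdiag x :: 'a::real_or_complex^'n::_^'m::_) \<bullet> rdiag y = x \<bullet> y"
  unfolding inner_rdiag[OF assms] rdiag_nth[OF assms] by (simp add: inner_vec_def of_real_def)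

lemma norm_rdiag:
  fixes x :: "real^'m::{finite,linorder}"
  assumes "CARD('m) \<le> CARD('n::{finite,linorder})"
  shows "norm (rdiag x :: 'a::real_or_complex^'n::_^'m::_) = norm x"
  by (simp add: norm_eq_sqrt_inner inner_rdiag_rdiag[OF assms])

lemma linear_rdiag:
  assumes "CARD('m::{finite,linorder}) \<le> CARD('n::{finite,linorder})"
  shows "linear (rdiag :: real^'m::_ \<Rightarrow> 'a::real_or_complex^'n::_^'m::_)"
  by (rule linearI) (auto simp: vec_eq_iff rdiag_nth[OF assms] of_real_def algebra_simps)

lemma bounded_linear_rdiag:
  assumes "CARD('m::{finite,linorder}) \<le> CARD('n::{finite,linorder})"
  shows "bounded_linear (rdiag :: real^'m::_ \<Rightarrow> 'a::real_or_complex^'n::_^'m::_)"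
  using linear_rdiag[OF assms] linear_conv_bounded_linear by blast

section \<open>Existence of the singular value decomposition\<close>

lemma sum_two_terms:
  fixes f :: "'i::finite \<Rightarrow> 'b::comm_monoid_add"
  assumes "i \<noteq> j" "\<And>k. k \<noteq> i \<Longrightarrow> k \<noteq> j \<Longrightarrow> f k = 0"
  shows "sum f UNIV = f i + f j"
proof -
  have "sum f UNIV = sum f {i, j}" using assms(2) by (intro sum.mono_neutral_right) auto
  then show ?thesis using assms(1) by simp
qed

lemma exists_decreasing_weights:
  "\<exists>w :: 'i::{finite,linorder} \<Rightarrow> real. (\<forall>i. 0 < w i) \<and> (\<forall>i j. i < j \<longrightarrow> w j < w i)"
  by (rule exI[of _ "\<lambda>i. real (card {i..})"]) (auto simp: card_gt_0_iff intro!: psubset_card_mono)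

text \<open>The Givens rotation in the plane of the coordinates \<open>i\<close> and \<open>j\<close>, unitary if \<open>c\<^sup>2 + |z|\<^sup>2 = 1\<close>.\<close>

definition givens :: "'p \<Rightarrow> 'p \<Rightarrow> real \<Rightarrow> 'a \<Rightarrow> 'a::real_or_complex^'p^'p" where
  "givens i j c z = (\<chi> a b.
     if a = b then (if a = i \<or> a = j then of_real c else 1)
     else if a = i \<and> b = j then z
     else if a = j \<and> b = i then - conjugate z else 0)"

lemma givens_nth:
  "givens i j c z $ a $ b =
     (if a = b then (if a = i \<or> a = j then of_real c else 1)
      else if a = i \<and> b = j then z
      else if a = j \<and> b = i then - conjugate z else 0)"
  by (simp add: givens_def)

lemma givens_mult:
  fixes M :: "'a::real_or_complex^'q^'p"
  assumes ij: "i \<noteq> j"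
  shows "(givens i j c z ** M) $ a $ b =
    (if a = i then of_real c * M $ i $ b + z * M $ j $ b
     else if a = j then of_real c * M $ j $ b - conjugate z * M $ i $ b
     else M $ a $ b)"
proof (cases "a = i \<or> a = j")
  case True
  have "(givens i j c z ** M) $ a $ b = givens i j c z $ a $ i * M $ i $ b + givens i j c z $ a $ j * M $ j $ b"
    unfolding matrix_matrix_mult_def vec_lambda_beta
  proof (rule sum_two_terms[OF ij])
    fix k assume "k \<noteq> i" "k \<noteq> j"
    then have "givens i j c z $ a $ k = 0" using True by (simp add: givens_nth) blast
    then show "givens i j c z $ a $ k * M $ k $ b = 0" by simp
  qed
  moreover have "givens i j c z $ i $ i = of_real c" "givens i j c z $ i $ j = z"
    "givens i j c z $ j $ i = - conjugate z" "givens i j c z $ j $ j = of_real c"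
    using ij by (simp_all add: givens_nth)
  ultimately show ?thesis using True ij by (elim disjE) simp_all
next
  case False
  then have "givens i j c z $ a $ k * M $ k $ b = (if k = a then M $ a $ b else 0)" for k
    by (simp add: givens_nth)
  then show ?thesis using False by (simp add: matrix_matrix_mult_def)
qed

lemma adj_givens:
  assumes "i \<noteq> j"
  shows "adj (givens i j c z) = givens i j c (- z)"
proof -
  have "conjugate (givens i j c z $ b $ a) = givens i j c (- z) $ a $ b" for a b
    using assms unfolding givens_nth by (simp add: conjugate_minus)
  then show ?thesis by (simp add: vec_eq_iff)
qed

lemma givens_unitary:
  fixes z :: "'a::real_or_complex"
  assumes ij: "i \<noteq> j" and cz: "c\<^sup>2 + (norm z)\<^sup>2 = 1"
  shows "givens i j c z \<in> unitary_mats"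
proof -
  have *: "givens i j c w ** givens i j c (- w) = mat 1" if "c\<^sup>2 + (norm w)\<^sup>2 = 1" for w :: 'a
  proof -
    have 1: "of_real c * of_real c + w * conjugate w = 1"
      using arg_cong[OF that, of "of_real :: real \<Rightarrow> 'a"] unfolding of_real_add mult_conjugate
      by (simp add: power2_eq_square)
    have 2: "of_real c * of_real c + conjugate w * w = 1"
      using 1 by (simp only: mult.commute)
    have 3: "of_real c * w = w * of_real c" "of_real c * conjugate w = conjugate w * of_real c"
      by (simp_all only: mult.commute)
    have nth: "givens i j c (- w) $ i $ i = of_real c" "givens i j c (- w) $ j $ j = of_real c"
      "givens i j c (- w) $ i $ j = - w" "givens i j c (- w) $ j $ i = conjugate w"
      "b \<noteq> i \<Longrightarrow> b \<noteq> j \<Longrightarrow> givens i j c (- w) $ i $ b = 0"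
      "b \<noteq> i \<Longrightarrow> b \<noteq> j \<Longrightarrow> givens i j c (- w) $ j $ b = 0"
      "a \<noteq> i \<Longrightarrow> a \<noteq> j \<Longrightarrow> givens i j c (- w) $ a $ b = mat 1 $ a $ b" for a b
      using ij by (auto simp: givens_nth conjugate_minus mat_def)
    have "(givens i j c w ** givens i j c (- w)) $ a $ b = mat 1 $ a $ b" for a b
    proof (cases "a = i \<or> a = j")
      case True
      then show ?thesis
        unfolding givens_mult[OF ij] using ij 1 2
        by (cases "b = i"; cases "b = j"; elim disjE)
          (simp_all add: nth mat_def 3)
    qed (simp add: givens_mult[OF ij] nth)
    then show ?thesis by (simp add: vec_eq_iff)
  qed
  show ?thesis
    using *[of z] *[of "- z"] cz ij by (intro unitary_matsI) (simp_all add: adj_givens)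
qed

definition phase :: "'p \<Rightarrow> 'a \<Rightarrow> 'a::real_or_complex^'p^'p" where
  "phase i z = (\<chi> a b. if a = b then (if a = i then z else 1) else 0)"

lemma phase_mult:
  fixes M :: "'a::real_or_complex^'q^'p"
  shows "(phase i z ** M) $ a $ b = (if a = i then z * M $ i $ b else M $ a $ b)"
proof -
  have "phase i z $ a $ k * M $ k $ b = (if k = a then (if a = i then z * M $ i $ b else M $ a $ b) else 0)" for k
    by (auto simp: phase_def)
  then show ?thesis by (simp add: matrix_matrix_mult_def)
qed

lemma phase_unitary:
  assumes "norm z = 1"
  shows "phase i z \<in> unitary_mats"
proof -
  have z: "z * conjugate z = 1" "conjugate z * z = 1"
    using assms by (simp_all add: mult_conjugate mult.commute[of "conjugate z"])
  have a: "adj (phase i z) = phase i (conjugate z)"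
    by (simp add: vec_eq_iff phase_def)
  have "(phase i x ** phase i y) = mat 1" if "x * y = 1" for x y :: 'a
    using that by (simp add: vec_eq_iff phase_mult) (simp add: phase_def mat_def)
  then show ?thesis
    unfolding unitary_mats_def a using z by (simp add: a)
qed

text \<open>A linear functional on the unit sphere of \<open>\<real> \<times> 'a\<close> can be maximal at \<open>(1, 0)\<close> only if its second
  component vanishes. Used for the rotations \<open>givens i j c z\<close>, it replaces the first-order optimality
  condition, so that no curve of unitary matrices has to be differentiated.\<close>

lemma circle_max_imp_zero:
  fixes u :: "'a::real_or_complex"
  assumes "\<And>c z. c\<^sup>2 + (norm z)\<^sup>2 = 1 \<Longrightarrow> c * a + z \<bullet> u \<le> a"
  shows "u = 0"
proof (rule ccontr)
  assume u: "u \<noteq> 0"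
  define r where "r = sqrt (a\<^sup>2 + (norm u)\<^sup>2)"
  have r2: "r\<^sup>2 = a\<^sup>2 + (norm u)\<^sup>2" and r0: "r > 0"
    using u by (simp_all add: r_def add_nonneg_pos)
  have "norm (u /\<^sub>R r) = norm u / r" using r0 by (simp add: divide_inverse mult.commute)
  then have "(a / r)\<^sup>2 + (norm (u /\<^sub>R r))\<^sup>2 = (a\<^sup>2 + (norm u)\<^sup>2) / r\<^sup>2"
    by (simp only: power_divide add_divide_distrib)
  then have "(a / r)\<^sup>2 + (norm (u /\<^sub>R r))\<^sup>2 = 1" using r0 unfolding r2[symmetric] by simp
  from assms[OF this] have "a / r * a + (u /\<^sub>R r) \<bullet> u \<le> a" .
  moreover have "(u /\<^sub>R r) \<bullet> u = (norm u)\<^sup>2 / r"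
    by (simp add: power2_norm_eq_inner divide_inverse mult.commute)
  ultimately have "(a\<^sup>2 + (norm u)\<^sup>2) / r \<le> a"
    by (simp add: add_divide_distrib power2_eq_square)
  then have "r \<le> a" using r0 unfolding r2[symmetric] by (simp add: power2_eq_square)
  then have "r\<^sup>2 \<le> a\<^sup>2" using r0 by (intro power_mono) auto
  then show False using r2 u by simp
qed

lemma phase_max_imp_real:
  fixes u :: "'a::real_or_complex"
  assumes "\<And>z. norm z = 1 \<Longrightarrow> z \<bullet> u \<le> 1 \<bullet> u"
  shows "\<exists>r\<ge>0. u = of_real r"
proof (cases "u = 0")
  case False
  then have "(u /\<^sub>R norm u) \<bullet> u \<le> 1 \<bullet> u" by (intro assms) simp
  moreover have "(u /\<^sub>R norm u) \<bullet> u = norm u"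
    using False by (simp add: power2_norm_eq_inner[symmetric] power2_eq_square)
  ultimately have "norm u \<le> 1 \<bullet> u" by simp
  then have "1 \<bullet> u = norm (1::'a) * norm u"
    using norm_cauchy_schwarz[of 1 u] by simp
  then have "u = norm u *\<^sub>R 1" using norm_cauchy_schwarz_eq[of 1 u] by simp
  then show ?thesis by (intro exI[of _ "norm u"]) (simp add: of_real_def)
qed (auto intro: exI[of _ 0])

text \<open>
  Choose unitary \<open>U\<close>, \<open>V\<close> that maximise \<open>\<Sum>\<^sub>k w\<^sub>k Re M\<^sub>k\<^sub>k\<close> for \<open>M = U X V\<close>, with strictly decreasing
  positive weights. Rotating the rows \<open>i, j\<close> of \<open>M\<close> does not increase the objective, whence
  \<open>w\<^sub>i conj(M\<^sub>j\<^sub>i) = w\<^sub>j M\<^sub>i\<^sub>j\<close>; rotating the columns gives \<open>w\<^sub>i M\<^sub>i\<^sub>j = w\<^sub>j conj(M\<^sub>j\<^sub>i)\<close>. As \<open>w\<^sub>i \<noteq> w\<^sub>j\<close>,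
  together they force \<open>M\<^sub>i\<^sub>j = 0\<close>. Changing the phase of a row shows that the diagonal entries are
  nonnegative reals, and exchanging two of them that they decrease. A column beyond the first \<open>m\<close> has no entry in
  the objective, so rotating it against one that has forces it to be zero.
\<close>

lemma svd_exists:
  fixes X :: "'a::real_or_complex^'n::{finite,linorder}^'m::{finite,linorder}"
  assumes mn: "CARD('m) \<le> CARD('n)"
  shows "\<exists>U s V. is_svd X U s V \<and> (\<forall>i. 0 \<le> s $ i) \<and> (\<forall>i j. i \<le> j \<longrightarrow> s $ j \<le> s $ i)"
proof -
  obtain w :: "'m \<Rightarrow> real" where w_pos: "\<And>i. 0 < w i" and w_less: "\<And>i j. i < j \<Longrightarrow> w j < w i"
    using exists_decreasing_weights by blast
  define \<phi> where "\<phi> M = (\<Sum>k\<in>UNIV. w k * (1 \<bullet> M $ k $ lead k))" for M :: "'a^'n::_^'m::_"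
  have "\<exists>p\<in>unitary_mats \<times> unitary_mats. \<forall>q\<in>unitary_mats \<times> unitary_mats.
      \<phi> (fst q ** X ** snd q) \<le> \<phi> (fst p ** X ** snd p)"
  proof (rule continuous_attains_sup)
    show "compact ((unitary_mats :: ('a^'m::_^'m::_) set) \<times> (unitary_mats :: ('a^'n::_^'n::_) set))"
      by (intro compact_Times compact_unitary_mats)
    show "(unitary_mats :: ('a^'m::_^'m::_) set) \<times> (unitary_mats :: ('a^'n::_^'n::_) set) \<noteq> {}"
      unfolding Times_empty using unitary_mats_1 by (metis empty_iff)
    show "continuous_on (unitary_mats \<times> unitary_mats) (\<lambda>q. \<phi> (fst q ** X ** snd q))"
    proof -
      have "\<phi> = (\<lambda>M. rdiag (\<chi> i. w i) \<bullet> M)" by (simp add: fun_eq_iff \<phi>_def inner_rdiag[OF mn])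
      moreover have "continuous_on (unitary_mats \<times> unitary_mats)
          (\<lambda>q. fst q ** X ** snd q :: 'a^'n::_^'m::_)"
        by (intro continuous_on_matrix_mult continuous_on_fst continuous_on_snd
            continuous_on_const continuous_on_id)
      ultimately show ?thesis by (simp add: continuous_on_inner)
    qed
  qed
  then obtain U V where UV: "U \<in> unitary_mats" "V \<in> unitary_mats"
    and max0: "\<And>U' V'. U' \<in> unitary_mats \<Longrightarrow> V' \<in> unitary_mats \<Longrightarrow> \<phi> (U' ** X ** V') \<le> \<phi> (U ** X ** V)"
    by auto
  define M where "M = U ** X ** V"
  have max: "\<phi> (P ** M ** Q) \<le> \<phi> M" if "P \<in> unitary_mats" "Q \<in> unitary_mats" for P Q
    using max0[of "P ** U" "V ** Q"] that UV by (simp add: M_def unitary_mats_mult matrix_mul_assoc)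
  have left: "\<phi> (P ** M) \<le> \<phi> M" if "P \<in> unitary_mats" for P
    using max[OF that unitary_mats_1] by simp
  have right: "\<phi> (M ** adj P) \<le> \<phi> M" if "P \<in> unitary_mats" for P
    using max[OF unitary_mats_1 unitary_mats_adj[OF that]] by simp
  have right_nth: "(M ** adj P) $ a $ b = conjugate ((P ** adj M) $ b $ a)" for P a b
  proof -
    have "M ** adj P = adj (P ** adj M)" by (simp add: adj_matrix_mult)
    then show ?thesis by (simp only: adj_nth)
  qed
  have two: "\<phi> M' - \<phi> M = w i * (1 \<bullet> (M' $ i $ lead i - M $ i $ lead i)) + w j * (1 \<bullet> (M' $ j $ lead j - M $ j $ lead j))"
    if "i \<noteq> j" "\<And>k. k \<noteq> i \<Longrightarrow> k \<noteq> j \<Longrightarrow> M' $ k $ lead k = M $ k $ lead k" for M' i j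
    unfolding \<phi>_def sum_subtractf[symmetric]
    by (subst sum_two_terms[OF that(1)]) (use that(2) in \<open>auto simp: algebra_simps\<close>)
  have one: "\<phi> M' - \<phi> M = w i * (1 \<bullet> (M' $ i $ lead i - M $ i $ lead i))"
    if "\<And>k. k \<noteq> i \<Longrightarrow> M' $ k $ lead k = M $ k $ lead k" for M' i
  proof -
    have "\<phi> M' - \<phi> M = (\<Sum>k\<in>{i}. w k * (1 \<bullet> M' $ k $ lead k) - w k * (1 \<bullet> M $ k $ lead k))"
      unfolding \<phi>_def sum_subtractf[symmetric] by (rule sum.mono_neutral_right) (use that in auto)
    then show ?thesis by (simp add: algebra_simps)
  qed
  note lead_eq = inj_eq[OF inj_lead[OF mn]]
  have swap1: "1 \<bullet> (z * y) = z \<bullet> conjugate y" for z y :: 'a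
  proof -
    have "1 \<bullet> (z * y) = y \<bullet> conjugate z"
      using inner_mult_conjugate[of z y 1] by (simp only: inner_commute mult_1_right)
    also have "\<dots> = conjugate z \<bullet> conjugate (conjugate y)" by (simp add: inner_commute)
    finally show ?thesis by (simp only: inner_conjugate_conjugate)
  qed
  have swap2: "1 \<bullet> conjugate y = 1 \<bullet> y" for y :: 'a
    using inner_conjugate_conjugate[of 1 y] by simp
  have swap3: "conjugate z \<bullet> y = z \<bullet> conjugate y" for z y :: 'a
    using inner_conjugate_conjugate[of z "conjugate y"] by simp
  have swap4: "conjugate z \<bullet> conjugate y = z \<bullet> y" for z y :: 'a
    by (rule inner_conjugate_conjugate)
  have re: "of_real c \<bullet> y = c * (1 \<bullet> y)" for c and y :: 'a
    by (simp add: of_real_def)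
  note swap = swap1 swap2 swap3 swap4 re
  have L: "w i *\<^sub>R conjugate (M $ j $ lead i) = w j *\<^sub>R M $ i $ lead j" if ij: "i \<noteq> j" for i j
  proof -
    have "w i *\<^sub>R conjugate (M $ j $ lead i) - w j *\<^sub>R M $ i $ lead j = 0"
    proof (rule circle_max_imp_zero)
      fix c and z :: 'a assume "c\<^sup>2 + (norm z)\<^sup>2 = 1"
      then have le: "\<phi> (givens i j c z ** M) - \<phi> M \<le> 0" using left[OF givens_unitary[OF ij]] by simp
      have "\<phi> (givens i j c z ** M) - \<phi> M =
        w i * (1 \<bullet> (of_real c * M $ i $ lead i + z * M $ j $ lead i - M $ i $ lead i))
        + w j * (1 \<bullet> (of_real c * M $ j $ lead j - conjugate z * M $ i $ lead j - M $ j $ lead j))"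
        by (subst two[OF ij]) (use ij in \<open>simp_all add: givens_mult[OF ij]\<close>)
      also have "\<dots> = w i * (c * (1 \<bullet> M $ i $ lead i) + z \<bullet> conjugate (M $ j $ lead i) - 1 \<bullet> M $ i $ lead i)
        + w j * (c * (1 \<bullet> M $ j $ lead j) - z \<bullet> M $ i $ lead j - 1 \<bullet> M $ j $ lead j)"
        by (simp only: inner_diff_right inner_add_right swap conjugate_conjugate)
      finally have eq: "\<phi> (givens i j c z ** M) - \<phi> M = \<dots>" .
      then show "c * (w i * (1 \<bullet> M $ i $ lead i) + w j * (1 \<bullet> M $ j $ lead j))
          + z \<bullet> (w i *\<^sub>R conjugate (M $ j $ lead i) - w j *\<^sub>R M $ i $ lead j)
        \<le> w i * (1 \<bullet> M $ i $ lead i) + w j * (1 \<bullet> M $ j $ lead j)"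
        using le unfolding eq by (simp add: inner_diff_right algebra_simps)
    qed
    then show ?thesis by simp
  qed
  have R: "w i *\<^sub>R M $ i $ lead j = w j *\<^sub>R conjugate (M $ j $ lead i)" if ij: "i \<noteq> j" for i j
  proof -
    have ij': "(lead i :: 'n) \<noteq> lead j" using ij lead_eq by simp
    have "w i *\<^sub>R M $ i $ lead j - w j *\<^sub>R conjugate (M $ j $ lead i) = 0"
    proof (rule circle_max_imp_zero)
      fix c and z :: 'a assume "c\<^sup>2 + (norm z)\<^sup>2 = 1"
      then have le: "\<phi> (M ** adj (givens (lead i) (lead j) c z)) - \<phi> M \<le> 0"
        using right[OF givens_unitary[OF ij']] by simp
      have "\<phi> (M ** adj (givens (lead i) (lead j) c z)) - \<phi> M =
        w i * (1 \<bullet> (conjugate (of_real c * conjugate (M $ i $ lead i) + z * conjugate (M $ i $ lead j)) - M $ i $ lead i))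
        + w j * (1 \<bullet> (conjugate (of_real c * conjugate (M $ j $ lead j) - conjugate z * conjugate (M $ j $ lead i)) - M $ j $ lead j))"
        by (subst two[OF ij])
          (use ij ij' in \<open>simp_all add: right_nth givens_mult[OF ij'] lead_eq\<close>)
      also have "\<dots> = w i * (c * (1 \<bullet> M $ i $ lead i) + z \<bullet> M $ i $ lead j - 1 \<bullet> M $ i $ lead i)
        + w j * (c * (1 \<bullet> M $ j $ lead j) - z \<bullet> conjugate (M $ j $ lead i) - 1 \<bullet> M $ j $ lead j)"
        by (simp only: inner_diff_right inner_add_right swap conjugate_conjugate)
      finally have eq: "\<phi> (M ** adj (givens (lead i) (lead j) c z)) - \<phi> M = \<dots>" .
      then show "c * (w i * (1 \<bullet> M $ i $ lead i) + w j * (1 \<bullet> M $ j $ lead j))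
          + z \<bullet> (w i *\<^sub>R M $ i $ lead j - w j *\<^sub>R conjugate (M $ j $ lead i))
        \<le> w i * (1 \<bullet> M $ i $ lead i) + w j * (1 \<bullet> M $ j $ lead j)"
        using le unfolding eq by (simp add: inner_diff_right algebra_simps)
    qed
    then show ?thesis by simp
  qed
  have off: "M $ i $ lead j = 0" if ij: "i \<noteq> j" for i j
  proof -
    have "(w i * w i) *\<^sub>R M $ i $ lead j = w j *\<^sub>R (w i *\<^sub>R conjugate (M $ j $ lead i))"
      unfolding scaleR_scaleR[symmetric] R[OF ij] by (rule scaleR_left_commute)
    also have "\<dots> = (w j * w j) *\<^sub>R M $ i $ lead j" using L[OF ij] by simp
    finally have "(w i * w i - w j * w j) *\<^sub>R M $ i $ lead j = 0" by (simp add: scaleR_diff_left)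
    moreover have "w i \<noteq> w j" using ij w_less[of i j] w_less[of j i] by (metis less_irrefl neqE)
    then have "w i * w i - w j * w j \<noteq> 0"
      using w_pos[of i] w_pos[of j] by (simp add: square_eq_iff)
    ultimately show ?thesis by simp
  qed
  have nonlead: "M $ i $ q = 0" if q: "q \<notin> range (lead :: 'm \<Rightarrow> 'n)" for i q
  proof -
    have iq: "lead i \<noteq> q" "\<And>k::'m. lead k \<noteq> q" using q by auto
    have "w i *\<^sub>R M $ i $ q = 0"
    proof (rule circle_max_imp_zero)
      fix c and z :: 'a assume "c\<^sup>2 + (norm z)\<^sup>2 = 1"
      then have le: "\<phi> (M ** adj (givens (lead i) q c z)) - \<phi> M \<le> 0"
        using right[OF givens_unitary[OF iq(1)]] by simp
      have "\<phi> (M ** adj (givens (lead i) q c z)) - \<phi> M =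
        w i * (1 \<bullet> (conjugate (of_real c * conjugate (M $ i $ lead i) + z * conjugate (M $ i $ q)) - M $ i $ lead i))"
        by (subst one[of i]) (use iq in \<open>simp_all add: right_nth givens_mult[OF iq(1)] lead_eq\<close>)
      also have "\<dots> = w i * (c * (1 \<bullet> M $ i $ lead i) + z \<bullet> M $ i $ q - 1 \<bullet> M $ i $ lead i)"
        by (simp only: inner_diff_right inner_add_right swap conjugate_conjugate)
      finally have eq: "\<phi> (M ** adj (givens (lead i) q c z)) - \<phi> M = \<dots>" .
      then show "c * (w i * (1 \<bullet> M $ i $ lead i)) + z \<bullet> (w i *\<^sub>R M $ i $ q) \<le> w i * (1 \<bullet> M $ i $ lead i)"
        using le unfolding eq by (simp add: algebra_simps)
    qed
    then show ?thesis using w_pos[of i] by simp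
  qed
  have "\<exists>r\<ge>0. M $ i $ lead i = of_real r" for i
  proof (rule phase_max_imp_real)
    fix z :: 'a assume z: "norm z = 1"
    have "norm (conjugate z) = 1" using z by simp
    then have "\<phi> (phase i (conjugate z) ** M) - \<phi> M \<le> 0" using left[OF phase_unitary] by simp
    moreover have "\<phi> (phase i (conjugate z) ** M) - \<phi> M = w i * (1 \<bullet> (conjugate z * M $ i $ lead i - M $ i $ lead i))"
      by (subst one[of i]) (simp_all add: phase_mult)
    moreover have "\<dots> = w i * (z \<bullet> M $ i $ lead i - 1 \<bullet> M $ i $ lead i)"
      by (simp only: inner_diff_right swap conjugate_conjugate)
    ultimately have "w i * (z \<bullet> M $ i $ lead i) \<le> w i * (1 \<bullet> M $ i $ lead i)"
      by (simp add: right_diff_distrib)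
    then show "z \<bullet> M $ i $ lead i \<le> 1 \<bullet> M $ i $ lead i" using w_pos[of i] by simp
  qed
  then obtain r where r: "\<And>i. r i \<ge> 0" "\<And>i. M $ i $ lead i = of_real (r i)" by metis
  have sorted: "r j \<le> r i" if "i \<le> j" for i j
  proof (cases "i = j")
    case False
    then have ij: "i < j" "i \<noteq> j" using that by auto
    have ij': "(lead i :: 'n) \<noteq> lead j" using ij lead_eq by simp
    \<comment> \<open>The quarter turns with \<open>c = 0\<close>, \<open>z = 1\<close> on both sides exchange the two diagonal entries;
      their signs cancel.\<close>
    let ?M = "givens i j 0 1 ** M ** adj (givens (lead i) (lead j) 0 1)"
    have nth: "?M $ a $ b = conjugate ((givens (lead i) (lead j) 0 1 ** adj (givens i j 0 1 ** M)) $ b $ a)" for a b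
    proof -
      have "?M = adj (givens (lead i) (lead j) 0 1 ** adj (givens i j 0 1 ** M))"
        by (simp add: adj_matrix_mult)
      then show ?thesis by (simp only: adj_nth)
    qed
    have M': "?M $ k $ lead k = (if k = i then M $ j $ lead j else if k = j then M $ i $ lead i else M $ k $ lead k)" for k
      unfolding nth givens_mult[OF ij'] adj_nth givens_mult[OF ij(2)]
      using ij ij' by (auto simp: lead_eq conjugate_minus)
    have "\<phi> ?M - \<phi> M \<le> 0" using max[OF givens_unitary[OF ij(2)] unitary_mats_adj[OF givens_unitary[OF ij']]] by simp
    then have "w i * (r j - r i) + w j * (r i - r j) \<le> 0"
      by (subst (asm) two[OF ij(2)]) (use ij(2) in \<open>simp_all add: M' r of_real_def inner_diff_right\<close>)
    then have "(w i - w j) * (r j - r i) \<le> 0" by (simp add: algebra_simps)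
    then show ?thesis using w_less[OF ij(1)] by (simp add: mult_le_0_iff)
  qed simp
  have "M = rdiag (\<chi> i. r i)"
  proof -
    have "M $ i $ l = (rdiag (\<chi> i. r i) :: 'a^'n::_^'m::_) $ i $ l" for i l
      using off[of i] nonlead[of l i] r(2)
      by (cases "l \<in> range (lead :: 'm \<Rightarrow> 'n)") (auto simp: rdiag_nth[OF mn] lead_eq)
    then show ?thesis by (simp add: vec_eq_iff)
  qed
  moreover have "X = adj U ** M ** adj V"
    by (simp add: M_def matrix_mul_assoc[symmetric] unitary_matsD[OF UV(1)] unitary_matsD[OF UV(2)])
  ultimately have "is_svd X (adj U) (\<chi> i. r i) V"
    using UV by (simp add: is_svd_def unitary_mats_adj)
  then show ?thesis using r(1) sorted by (intro exI[of _ "adj U"] exI[of _ "\<chi> i. r i"] exI[of _ V]) simp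
qed

section \<open>Perturbation of singular values\<close>

text \<open>A decreasing nonnegative family is a nonnegative combination of indicators of initial segments.
  This makes initial segments the extreme case of the inequalities below.\<close>

lemma decreasing_eq_sum:
  fixes s :: "'i::linorder \<Rightarrow> real"
  assumes "finite A" "\<And>i. i \<in> A \<Longrightarrow> 0 \<le> s i" "\<And>i j. i \<in> A \<Longrightarrow> j \<in> A \<Longrightarrow> i \<le> j \<Longrightarrow> s j \<le> s i"
  shows "\<exists>a. (\<forall>k\<in>A. 0 \<le> a k) \<and> (\<forall>i\<in>A. s i = (\<Sum>k\<in>{k\<in>A. i \<le> k}. a k))"
  using assms
proof (induction A arbitrary: s rule: finite_linorder_max_induct)
  case (insert b A)
  have "\<exists>a. (\<forall>k\<in>A. 0 \<le> a k) \<and> (\<forall>i\<in>A. s i - s b = (\<Sum>k\<in>{k\<in>A. i \<le> k}. a k))"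
    by (rule insert.IH) (use insert.prems insert.hyps in \<open>auto simp: less_imp_le\<close>)
  then obtain a where a: "\<And>k. k \<in> A \<Longrightarrow> 0 \<le> a k"
    "\<And>i. i \<in> A \<Longrightarrow> s i - s b = (\<Sum>k\<in>{k\<in>A. i \<le> k}. a k)" by blast
  have b: "b \<notin> A" using insert.hyps by blast
  have "s i = (\<Sum>k\<in>{k\<in>insert b A. i \<le> k}. (a(b := s b)) k)" if i: "i \<in> insert b A" for i
  proof (cases "i = b")
    case True
    then have "{k\<in>insert b A. i \<le> k} = {b}" using insert.hyps by force
    then show ?thesis using True by simp
  next
    case False
    then have i: "i \<in> A" "i < b" using that insert.hyps by auto
    then have "{k\<in>insert b A. i \<le> k} = insert b {k\<in>A. i \<le> k}" by auto
    moreover have "(\<Sum>k\<in>{k\<in>A. i \<le> k}. (a(b := s b)) k) = (\<Sum>k\<in>{k\<in>A. i \<le> k}. a k)"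
      using b by (intro sum.cong) auto
    ultimately show ?thesis using a(2)[OF i(1)] b insert.hyps(1) by simp
  qed
  moreover have "\<forall>k\<in>insert b A. 0 \<le> (a(b := s b)) k" using a(1) insert.prems(1) by auto
  ultimately show ?case by blast
qed simp

lemma abel_sum_mono:
  fixes s x y :: "'i::{finite,linorder} \<Rightarrow> real"
  assumes "\<And>i. 0 \<le> s i" "\<And>i j. i \<le> j \<Longrightarrow> s j \<le> s i"
    and le: "\<And>k. (\<Sum>i\<in>{..k}. x i) \<le> (\<Sum>i\<in>{..k}. y i)"
  shows "(\<Sum>i\<in>UNIV. s i * x i) \<le> (\<Sum>i\<in>UNIV. s i * y i)"
proof -
  obtain a where a: "\<And>k. 0 \<le> a k" "\<And>i. s i = (\<Sum>k\<in>{k. i \<le> k}. a k)"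
    using decreasing_eq_sum[of UNIV s] assms(1,2) by auto
  have *: "(\<Sum>i\<in>UNIV. s i * z i) = (\<Sum>k\<in>UNIV. a k * (\<Sum>i\<in>{..k}. z i))" for z :: "'i \<Rightarrow> real"
  proof -
    have "(\<Sum>i\<in>UNIV. s i * z i) = (\<Sum>i\<in>UNIV. \<Sum>k\<in>UNIV. if i \<le> k then a k * z i else 0)"
      by (simp add: a(2) sum_distrib_right sum.If_cases)
    also have "\<dots> = (\<Sum>k\<in>UNIV. \<Sum>i\<in>UNIV. if i \<le> k then a k * z i else 0)" by (rule sum.swap)
    also have "\<dots> = (\<Sum>k\<in>UNIV. a k * (\<Sum>i\<in>{..k}. z i))"
      by (simp add: sum_distrib_left sum.If_cases atMost_def)
    finally show ?thesis .
  qed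
  show ?thesis unfolding * by (intro sum_mono mult_left_mono le a(1))
qed

text \<open>By two applications of \<open>abel_sum_mono\<close> both families become indicators of initial segments of lengths
  \<open>k\<close> and \<open>l\<close>. In this case the sum of \<open>d\<close> over the rectangle is at most \<open>min k l\<close>, by the row or the
  column sums, and this is the right-hand side.\<close>

lemma substochastic_sum_le:
  fixes s t :: "'i::{finite,linorder} \<Rightarrow> real"
  assumes s: "\<And>i. 0 \<le> s i" "\<And>i j. i \<le> j \<Longrightarrow> s j \<le> s i"
    and t: "\<And>i. 0 \<le> t i" "\<And>i j. i \<le> j \<Longrightarrow> t j \<le> t i"
    and d: "\<And>i j. 0 \<le> d i j" "\<And>i. (\<Sum>j\<in>UNIV. d i j) \<le> 1" "\<And>j. (\<Sum>i\<in>UNIV. d i j) \<le> 1"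
  shows "(\<Sum>i\<in>UNIV. s i * (\<Sum>j\<in>UNIV. t j * d i j)) \<le> (\<Sum>i\<in>UNIV. s i * t i)"
proof (rule abel_sum_mono[OF s])
  fix k
  have "(\<Sum>i\<in>{..k}. \<Sum>j\<in>UNIV. t j * d i j) = (\<Sum>j\<in>UNIV. t j * (\<Sum>i\<in>{..k}. d i j))"
    unfolding sum_distrib_left by (rule sum.swap)
  also have "\<dots> \<le> (\<Sum>j\<in>UNIV. t j * (if j \<le> k then 1 else 0))"
  proof (rule abel_sum_mono[OF t])
    fix l
    have 1: "(\<Sum>i\<in>{..k}. d i j) \<le> 1" for j
      using sum_mono2[of UNIV "{..k}" "\<lambda>i. d i j"] d(1,3) by (meson finite order_trans subset_UNIV)
    have 2: "(\<Sum>j\<in>{..l}. d i j) \<le> 1" for i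
      using sum_mono2[of UNIV "{..l}" "d i"] d(1,2) by (meson finite order_trans subset_UNIV)
    show "(\<Sum>j\<in>{..l}. \<Sum>i\<in>{..k}. d i j) \<le> (\<Sum>j\<in>{..l}. if j \<le> k then 1 else 0)"
    proof (cases "l \<le> k")
      case True
      then have "(\<Sum>j\<in>{..l}. if j \<le> k then 1 else 0) = (\<Sum>j\<in>{..l}. 1::real)"
        by (intro sum.cong) auto
      then show ?thesis using sum_mono[of "{..l}" _ "\<lambda>_. 1", OF 1] by simp
    next
      case False
      then have "(\<Sum>j\<in>{..l}. if j \<le> k then 1 else 0) = (\<Sum>i\<in>{..k}. 1::real)"
        by (intro sum.mono_neutral_cong_right) auto
      then show ?thesis using sum_mono[of "{..k}" _ "\<lambda>_. 1", OF 2] by (subst sum.swap) simp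
    qed
  qed
  also have "\<dots> = (\<Sum>i\<in>{..k}. t i)"
    by (simp add: if_distrib[of "\<lambda>u. _ * u"] sum.If_cases atMost_def cong: if_cong)
  finally show "(\<Sum>i\<in>{..k}. \<Sum>j\<in>UNIV. t j * d i j) \<le> (\<Sum>i\<in>{..k}. t i)" .
qed

definition nonneg_decreasing :: "real^'m::{finite,linorder} \<Rightarrow> bool" where
  "nonneg_decreasing s \<longleftrightarrow> (\<forall>i. 0 \<le> s $ i) \<and> (\<forall>i j. i \<le> j \<longrightarrow> s $ j \<le> s $ i)"

text \<open>
  Von Neumann's trace inequality. With \<open>A = U\<^sup>* P\<close> and \<open>B = W\<^sup>* V\<close> the left-hand side is
  \<open>\<Sum>\<^sub>i\<^sub>k x\<^sub>i t\<^sub>k Re(A\<^sub>i\<^sub>k B\<^sub>k\<^sub>i)\<close>, and \<open>|A\<^sub>i\<^sub>k B\<^sub>k\<^sub>i|\<close> is at most the mean of the squares, a doubly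
  substochastic matrix. The entries of \<open>x\<close> may be permuted and of any sign, so that the inequality
  also identifies the singular values of \<open>U D\<^sub>x V\<^sup>*\<close>.
\<close>

lemma inner_rdiag_le:
  fixes x s t :: "real^'m::{finite,linorder}" and U P :: "'a::real_or_complex^'m::_^'m::_"
    and V W :: "'a^'n::{finite,linorder}^'n::_"
  assumes mn: "CARD('m) \<le> CARD('n)"
    and un: "U \<in> unitary_mats" "V \<in> unitary_mats" "P \<in> unitary_mats" "W \<in> unitary_mats"
    and s: "nonneg_decreasing s" and t: "nonneg_decreasing t"
    and \<pi>: "bij \<pi>" and x: "\<And>i. \<bar>x $ i\<bar> = s $ \<pi> i"
  shows "(U ** rdiag x ** adj V) \<bullet> (P ** rdiag t ** adj W) \<le> s \<bullet> t"
proof -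
  define A where "A = adj U ** P"
  define B where "B = adj W ** V"
  have AB: "A \<in> unitary_mats" "B \<in> unitary_mats"
    using un by (simp_all add: A_def B_def unitary_mats_mult unitary_mats_adj)
  define d where "d i k = ((norm (A $ i $ k))\<^sup>2 + (norm (B $ lead k $ lead i))\<^sup>2) / 2" for i k :: 'm
  have sub: "(\<Sum>k\<in>(UNIV :: 'm set). f (lead k)) \<le> (\<Sum>l\<in>UNIV. f l)" if "\<And>l. 0 \<le> f l" for f :: "'n \<Rightarrow> real"
  proof -
    have "(\<Sum>k\<in>(UNIV :: 'm set). f (lead k)) = sum f (range (lead :: 'm \<Rightarrow> 'n))"
      by (simp add: sum.reindex[OF inj_lead[OF mn]])
    also have "\<dots> \<le> (\<Sum>l\<in>UNIV. f l)" using that by (intro sum_mono2) auto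
    finally show ?thesis .
  qed
  have d: "0 \<le> d i k" "(\<Sum>k\<in>UNIV. d i k) \<le> 1" "(\<Sum>i\<in>UNIV. d i k) \<le> 1" for i k
  proof -
    show "0 \<le> d i k" by (simp add: d_def)
    have "(\<Sum>k\<in>UNIV. d i k) =
        ((\<Sum>k\<in>UNIV. (norm (A $ i $ k))\<^sup>2) + (\<Sum>k\<in>(UNIV :: 'm set). (norm (B $ lead k $ lead i))\<^sup>2)) / 2"
      by (simp add: d_def sum_divide_distrib[symmetric] sum.distrib)
    then show "(\<Sum>k\<in>UNIV. d i k) \<le> 1"
      using unitary_row_sum[OF AB(1), of i] unitary_col_sum[OF AB(2), of "lead i"]
        sub[of "\<lambda>l. (norm (B $ l $ lead i))\<^sup>2"] by simp
    have "(\<Sum>i\<in>UNIV. d i k) =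
        ((\<Sum>i\<in>UNIV. (norm (A $ i $ k))\<^sup>2) + (\<Sum>i\<in>(UNIV :: 'm set). (norm (B $ lead k $ lead i))\<^sup>2)) / 2"
      by (simp add: d_def sum_divide_distrib[symmetric] sum.distrib)
    then show "(\<Sum>i\<in>UNIV. d i k) \<le> 1"
      using unitary_col_sum[OF AB(1), of k] unitary_row_sum[OF AB(2), of "lead k"]
        sub[of "\<lambda>l. (norm (B $ lead k $ l))\<^sup>2"] by simp
  qed
  have t0: "0 \<le> t $ i" for i using t by (simp add: nonneg_decreasing_def)
  have entry: "(A ** rdiag t ** B) $ i $ lead i = (\<Sum>k\<in>UNIV. A $ i $ k * (of_real (t $ k) * B $ lead k $ lead i))" for i
  proof -
    have "(A ** rdiag t ** B) $ i $ lead i = (A ** ((rdiag t :: 'a^'n::_^'m::_) ** B)) $ i $ lead i"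
      by (simp only: matrix_mul_assoc)
    also have "\<dots> = (\<Sum>k\<in>UNIV. A $ i $ k * ((rdiag t :: 'a^'n::_^'m::_) ** B) $ k $ lead i)"
      by (simp only: matrix_matrix_mult_def[of A] vec_lambda_beta)
    finally show ?thesis by (simp only: Diag_block_mult[OF mn])
  qed
  have bound: "x $ i * (1 \<bullet> (A ** rdiag t ** B) $ i $ lead i) \<le> s $ \<pi> i * (\<Sum>k\<in>UNIV. t $ k * d i k)" for i
  proof -
    have "norm ((A ** rdiag t ** B) $ i $ lead i) \<le> (\<Sum>k\<in>UNIV. t $ k * d i k)"
      unfolding entry
    proof (rule sum_norm_le)
      fix k
      have "norm (A $ i $ k) * norm (B $ lead k $ lead i) \<le> d i k"
        unfolding d_def using sum_squares_bound[of "norm (A $ i $ k)" "norm (B $ lead k $ lead i)"] by simp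
      then have "t $ k * (norm (A $ i $ k) * norm (B $ lead k $ lead i)) \<le> t $ k * d i k"
        by (intro mult_left_mono t0)
      then show "norm (A $ i $ k * (of_real (t $ k) * B $ lead k $ lead i)) \<le> t $ k * d i k"
        using t0[of k] by (simp add: norm_mult mult_ac)
    qed
    moreover have "\<bar>1 \<bullet> (A ** rdiag t ** B) $ i $ lead i\<bar> \<le> norm ((A ** rdiag t ** B) $ i $ lead i)"
      using Cauchy_Schwarz_ineq2[of 1 "(A ** rdiag t ** B) $ i $ lead i"] by simp
    ultimately have "\<bar>x $ i\<bar> * \<bar>1 \<bullet> (A ** rdiag t ** B) $ i $ lead i\<bar> \<le> \<bar>x $ i\<bar> * (\<Sum>k\<in>UNIV. t $ k * d i k)"
      by (intro mult_left_mono) auto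
    then show ?thesis unfolding x[symmetric] by (simp add: abs_mult[symmetric] abs_le_iff)
  qed
  define \<rho> where "\<rho> = inv \<pi>"
  have \<rho>: "bij \<rho>" "\<And>i. \<pi> (\<rho> i) = i"
    using \<pi> by (simp_all add: \<rho>_def bij_imp_bij_inv bij_is_surj surj_f_inv_f)
  have re: "(\<Sum>i\<in>UNIV. f i) = (\<Sum>i\<in>UNIV. f (\<rho> i))" for f :: "'m \<Rightarrow> real"
    using sum.reindex_bij_betw[OF \<rho>(1), of f] by simp
  have "(U ** rdiag x ** adj V) \<bullet> (P ** rdiag t ** adj W) = rdiag x \<bullet> (A ** rdiag t ** B)"
    by (simp only: inner_matrix_mult_right[of "U ** rdiag x" "adj V"] inner_matrix_mult_left[of U]
        A_def B_def adj_adj matrix_mul_assoc)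
  also have "\<dots> = (\<Sum>i\<in>UNIV. x $ i * (1 \<bullet> (A ** rdiag t ** B) $ i $ lead i))"
    by (rule inner_rdiag[OF mn])
  also have "\<dots> \<le> (\<Sum>i\<in>UNIV. s $ \<pi> i * (\<Sum>k\<in>UNIV. t $ k * d i k))"
    by (intro sum_mono bound)
  also have "\<dots> = (\<Sum>i\<in>UNIV. s $ i * (\<Sum>k\<in>UNIV. t $ k * d (\<rho> i) k))"
    by (subst re) (simp only: \<rho>(2))
  also have "\<dots> \<le> (\<Sum>i\<in>UNIV. s $ i * t $ i)"
  proof (rule substochastic_sum_le)
    show "(\<Sum>i\<in>UNIV. d (\<rho> i) j) \<le> 1" for j using d(3)[of j] re[of "\<lambda>i. d i j"] by simp
  qed (use s t d in \<open>auto simp: nonneg_decreasing_def\<close>)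
  also have "\<dots> = s \<bullet> t" by (simp add: inner_vec_def)
  finally show ?thesis .
qed

text \<open>Mirsky's inequality: expand both squared distances; the squared norms agree, since the frames are unitary, and
  the mixed terms compare by \<open>inner_rdiag_le\<close>.\<close>

lemma norm_diff_rdiag_ge:
  fixes x s t :: "real^'m::{finite,linorder}" and U P :: "'a::real_or_complex^'m::_^'m::_"
    and V W :: "'a^'n::{finite,linorder}^'n::_"
  assumes mn: "CARD('m) \<le> CARD('n)"
    and un: "U \<in> unitary_mats" "V \<in> unitary_mats" "P \<in> unitary_mats" "W \<in> unitary_mats"
    and s: "nonneg_decreasing s" and t: "nonneg_decreasing t"
    and \<pi>: "bij \<pi>" and x: "\<And>i. \<bar>x $ i\<bar> = s $ \<pi> i"
  shows "norm (s - t) \<le> norm (U ** rdiag x ** adj V - P ** rdiag t ** adj W)"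
proof -
  let ?X = "U ** rdiag x ** adj V" and ?Y = "P ** rdiag t ** adj W"
  have "s \<bullet> s = (\<Sum>i\<in>UNIV. s $ \<pi> i * s $ \<pi> i)"
    using sum.reindex_bij_betw[OF \<pi>, of "\<lambda>i. s $ i * s $ i"] by (simp add: inner_vec_def)
  also have "\<dots> = x \<bullet> x" by (simp add: inner_vec_def x[symmetric])
  also have "\<dots> = ?X \<bullet> ?X"
    by (simp add: inner_unitary[OF un(1,2)] inner_rdiag_rdiag[OF mn])
  finally have X: "?X \<bullet> ?X = s \<bullet> s" by simp
  have Y: "?Y \<bullet> ?Y = t \<bullet> t" by (simp add: inner_unitary[OF un(3,4)] inner_rdiag_rdiag[OF mn])
  have "(s - t) \<bullet> (s - t) = s \<bullet> s + t \<bullet> t - 2 * (s \<bullet> t)"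
    by (simp add: inner_diff_left inner_diff_right inner_commute)
  also have "\<dots> \<le> ?X \<bullet> ?X + ?Y \<bullet> ?Y - 2 * (?X \<bullet> ?Y)"
    using inner_rdiag_le[OF mn un s t \<pi> x] unfolding X Y by simp
  also have "\<dots> = (?X - ?Y) \<bullet> (?X - ?Y)"
    by (simp add: inner_diff_left inner_diff_right inner_commute)
  finally show ?thesis unfolding norm_eq_sqrt_inner by simp
qed

text \<open>Two decompositions of the same matrix are at distance zero, so Mirsky's inequality gives uniqueness.\<close>

lemma singular_values_signed_permutation:
  fixes x s :: "real^'m::{finite,linorder}" and U :: "'a::real_or_complex^'m::_^'m::_"
    and V :: "'a^'n::{finite,linorder}^'n::_"
  assumes mn: "CARD('m) \<le> CARD('n)" and un: "U \<in> unitary_mats" "V \<in> unitary_mats"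
    and s: "nonneg_decreasing s" and \<pi>: "bij \<pi>" and x: "\<And>i. \<bar>x $ i\<bar> = s $ \<pi> i"
  shows "singular_values (U ** rdiag x ** adj V) = s"
proof -
  let ?X = "U ** rdiag x ** adj V"
  have eq: "t = s" if "nonneg_decreasing t" "is_svd ?X P t W" for t P W
  proof -
    have P: "P \<in> unitary_mats" "W \<in> unitary_mats" "?X = P ** rdiag t ** adj W"
      using that(2) unfolding is_svd_def by blast+
    show ?thesis
      using norm_diff_rdiag_ge[OF mn un P(1,2) s that(1) \<pi> x] unfolding P(3) by simp
  qed
  obtain P t W where "is_svd ?X P t W" "nonneg_decreasing t"
    using svd_exists[OF mn, of ?X] unfolding nonneg_decreasing_def by blast
  with eq[OF this(2,1)] have "\<exists>P W. is_svd ?X P s W" by blast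
  then show ?thesis
    unfolding singular_values_def using s eq unfolding nonneg_decreasing_def by (intro the_equality) blast+
qed

lemma singular_values_eq:
  fixes X :: "'a::real_or_complex^'n::{finite,linorder}^'m::{finite,linorder}"
  assumes mn: "CARD('m) \<le> CARD('n)" and "is_svd X U s V" and s: "nonneg_decreasing s"
  shows "singular_values X = s"
  using singular_values_signed_permutation[OF mn, of U V s id s] assms
  by (simp add: is_svd_def nonneg_decreasing_def)

lemma svd_singular_values:
  fixes X :: "'a::real_or_complex^'n::{finite,linorder}^'m::{finite,linorder}"
  assumes mn: "CARD('m) \<le> CARD('n)"
  obtains U V where "is_svd X U (singular_values X) V"
proof -
  obtain U s V where "is_svd X U s V" "nonneg_decreasing s"
    using svd_exists[OF mn, of X] unfolding nonneg_decreasing_def by blast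
  then show ?thesis using singular_values_eq[OF mn] that by metis
qed

lemma nonneg_decreasing_singular_values:
  fixes X :: "'a::real_or_complex^'n::{finite,linorder}^'m::{finite,linorder}"
  assumes mn: "CARD('m) \<le> CARD('n)"
  shows "nonneg_decreasing (singular_values X)"
proof -
  obtain U s V where "is_svd X U s V" "nonneg_decreasing s"
    using svd_exists[OF mn, of X] unfolding nonneg_decreasing_def by blast
  then show ?thesis using singular_values_eq[OF mn] by metis
qed

lemma singular_values_nonexpansive:
  fixes X Y :: "'a::real_or_complex^'n::{finite,linorder}^'m::{finite,linorder}"
  assumes mn: "CARD('m) \<le> CARD('n)"
  shows "norm (singular_values X - singular_values Y) \<le> norm (X - Y)"
proof -
  obtain U V where X: "is_svd X U (singular_values X) V" using svd_singular_values[OF mn] .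
  obtain P W where Y: "is_svd Y P (singular_values Y) W" using svd_singular_values[OF mn] .
  note nd = nonneg_decreasing_singular_values[OF mn]
  have un: "U \<in> unitary_mats" "V \<in> unitary_mats" "P \<in> unitary_mats" "W \<in> unitary_mats"
    and XY: "X = U ** rdiag (singular_values X) ** adj V" "Y = P ** rdiag (singular_values Y) ** adj W"
    using X Y unfolding is_svd_def by blast+
  have "\<bar>singular_values X $ i\<bar> = singular_values X $ id i" for i
    using nd[of X] by (simp add: nonneg_decreasing_def)
  from norm_diff_rdiag_ge[OF mn un nd[of X] nd[of Y] bij_id this] show ?thesis
    by (simp only: XY[symmetric])
qed

text \<open>The permutation that maximises a sum with strictly decreasing weights sorts the entries, since
  otherwise exchanging two of them would increase the sum.\<close>

lemma exists_decreasing_rearrangement: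
  fixes x :: "real^'m::{finite,linorder}"
  shows "\<exists>\<pi> (s :: real^'m::_). bij \<pi> \<and> nonneg_decreasing s \<and> (\<forall>i. \<bar>x $ i\<bar> = s $ \<pi> i)"
proof -
  obtain w :: "'m \<Rightarrow> real" where w_less: "\<And>i j. i < j \<Longrightarrow> w j < w i"
    using exists_decreasing_weights by blast
  define \<phi> where "\<phi> p = (\<Sum>i\<in>UNIV. w i * \<bar>x $ p i\<bar>)" for p :: "'m \<Rightarrow> 'm"
  have fin: "finite (\<phi> ` {p. bij p})" by simp
  have "\<phi> id \<in> \<phi> ` {p. bij p}" using bij_id by blast
  then have "Max (\<phi> ` {p. bij p}) \<in> \<phi> ` {p. bij p}" using Max_in[OF fin] by blast
  then obtain p where p: "bij p" "\<phi> p = Max (\<phi> ` {p. bij p})" by auto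
  have max: "\<phi> q \<le> \<phi> p" if "bij q" for q
    unfolding p(2) using fin that by (intro Max_ge) auto
  have dec: "\<bar>x $ p j\<bar> \<le> \<bar>x $ p i\<bar>" if "i \<le> j" for i j
  proof (cases "i = j")
    case False
    then have ij: "i < j" "i \<noteq> j" using that by auto
    have "bij (p \<circ> Transposition.transpose i j)" using p(1) by (simp add: bij_comp)
    then have "\<phi> (p \<circ> Transposition.transpose i j) - \<phi> p \<le> 0" using max by simp
    moreover have "\<phi> (p \<circ> Transposition.transpose i j) - \<phi> p =
        w i * (\<bar>x $ p j\<bar> - \<bar>x $ p i\<bar>) + w j * (\<bar>x $ p i\<bar> - \<bar>x $ p j\<bar>)"
      unfolding \<phi>_def sum_subtractf[symmetric]
      by (subst sum_two_terms[OF ij(2)]) (auto simp: right_diff_distrib)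
    ultimately have "(w i - w j) * (\<bar>x $ p j\<bar> - \<bar>x $ p i\<bar>) \<le> 0" by (simp add: algebra_simps)
    then show ?thesis using w_less[OF ij(1)] by (simp add: mult_le_0_iff)
  qed simp
  have "nonneg_decreasing (\<chi> i. \<bar>x $ p i\<bar>)" using dec by (simp add: nonneg_decreasing_def)
  moreover have "bij (inv p)" "\<And>i. p (inv p i) = i"
    using p(1) by (simp_all add: bij_imp_bij_inv bij_is_surj surj_f_inv_f)
  moreover have "\<forall>i. \<bar>x $ i\<bar> = (\<chi> i. \<bar>x $ p i\<bar>) $ inv p i"
    using p(1) by (simp add: bij_is_surj surj_f_inv_f)
  ultimately show ?thesis by blast
qed

section \<open>Odd polynomials and Hermite interpolation\<close>

text \<open>Odd real polynomials together with their derivatives, generated in such a way that every step has a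
  counterpart for matrices; the last one is \<open>F \<mapsto> Y Y\<^sup>* F(Y)\<close>.\<close>

inductive odd_poly :: "(real \<Rightarrow> real) \<Rightarrow> (real \<Rightarrow> real) \<Rightarrow> bool" where
  id: "odd_poly (\<lambda>x. x) (\<lambda>x. 1)"
| add: "odd_poly f f' \<Longrightarrow> odd_poly h h' \<Longrightarrow> odd_poly (\<lambda>x. f x + h x) (\<lambda>x. f' x + h' x)"
| scale: "odd_poly f f' \<Longrightarrow> odd_poly (\<lambda>x. c * f x) (\<lambda>x. c * f' x)"
| square_mult: "odd_poly f f' \<Longrightarrow> odd_poly (\<lambda>x. x\<^sup>2 * f x) (\<lambda>x. 2 * x * f x + x\<^sup>2 * f' x)"

lemma odd_poly_has_derivative: "odd_poly f f' \<Longrightarrow> (f has_real_derivative f' x) (at x)"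
  by (induction rule: odd_poly.induct) (auto intro!: derivative_eq_intros simp: algebra_simps)

lemma odd_poly_minus: "odd_poly f f' \<Longrightarrow> f (- x) = - f x"
  by (induction rule: odd_poly.induct) (auto simp: algebra_simps)

lemma odd_poly_0: "odd_poly f f' \<Longrightarrow> f 0 = 0"
  using odd_poly_minus[of f f' 0] by simp

lemma odd_poly_even_mult:
  assumes "odd_poly f f'"
  shows "odd_poly (\<lambda>x. (x\<^sup>2 - c) * f x) (\<lambda>x. 2 * x * f x + (x\<^sup>2 - c) * f' x)"
proof -
  have "odd_poly (\<lambda>x. x\<^sup>2 * f x + (- c) * f x) (\<lambda>x. (2 * x * f x + x\<^sup>2 * f' x) + (- c) * f' x)"
    by (intro odd_poly.add odd_poly.scale odd_poly.square_mult assms)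
  then show ?thesis by (simp add: algebra_simps)
qed

text \<open>The polynomial is \<open>x \<Prod> (x\<^sup>2 - u\<^sup>2)\<^sup>2\<close>. At the new node \<open>v = 0\<close>, where every odd polynomial vanishes, it is
  its derivative that does not.\<close>

lemma odd_node_polynomial:
  assumes "finite S" "\<And>u. u \<in> S \<Longrightarrow> 0 \<le> u" "0 \<le> v" "v \<notin> S"
  shows "\<exists>w w'. odd_poly w w' \<and> (\<forall>u\<in>S. w u = 0 \<and> w' u = 0) \<and> (if v = 0 then w' v \<noteq> 0 else w v \<noteq> 0)"
  using assms
proof (induction S)
  case empty
  show ?case by (intro exI conjI, rule odd_poly.id) auto
next
  case (insert u S)
  then obtain w w' where w: "odd_poly w w'" "\<And>u. u \<in> S \<Longrightarrow> w u = 0 \<and> w' u = 0"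
    "if v = 0 then w' v \<noteq> 0 else w v \<noteq> 0" by auto
  have "v\<^sup>2 \<noteq> u\<^sup>2" using insert.prems(1)[of u] insert.prems(2,3) by (auto simp: power2_eq_iff)
  show ?case
  proof (intro exI conjI)
    show "odd_poly (\<lambda>x. (x\<^sup>2 - u\<^sup>2) * ((x\<^sup>2 - u\<^sup>2) * w x))
        (\<lambda>x. 2 * x * ((x\<^sup>2 - u\<^sup>2) * w x) + (x\<^sup>2 - u\<^sup>2) * (2 * x * w x + (x\<^sup>2 - u\<^sup>2) * w' x))"
      by (intro odd_poly_even_mult w(1))
  qed (use \<open>v\<^sup>2 \<noteq> u\<^sup>2\<close> w(2,3) in \<open>auto split: if_splits\<close>)
qed

text \<open>A new node \<open>v\<close> is added by a correction \<open>(\<alpha> + \<beta> (x\<^sup>2 - v\<^sup>2)) w(x)\<close>, where \<open>w\<close> has double zeros at the old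
  nodes. Values and derivatives can be prescribed freely at nonnegative nodes, except for the value at zero.\<close>

lemma odd_hermite_interpolation:
  assumes "finite S" "\<And>u. u \<in> S \<Longrightarrow> 0 \<le> u" "0 \<in> S \<Longrightarrow> a 0 = 0"
  shows "\<exists>f f'. odd_poly f f' \<and> (\<forall>u\<in>S. f u = a u \<and> f' u = b u)"
  using assms
proof (induction S)
  case empty
  show ?case using odd_poly.id by blast
next
  case (insert v S)
  then obtain f f' where f: "odd_poly f f'" "\<And>u. u \<in> S \<Longrightarrow> f u = a u \<and> f' u = b u" by auto
  obtain w w' where w: "odd_poly w w'" "\<And>u. u \<in> S \<Longrightarrow> w u = 0 \<and> w' u = 0"
    "if v = 0 then w' v \<noteq> 0 else w v \<noteq> 0"
    using odd_node_polynomial[of S v] insert by auto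
  define \<alpha> where "\<alpha> = (if v = 0 then (b 0 - f' 0) / w' 0 else (a v - f v) / w v)"
  define \<beta> where "\<beta> = (if v = 0 then 0 else (b v - f' v - \<alpha> * w' v) / (2 * v * w v))"
  have *: "odd_poly (\<lambda>x. (f x + \<alpha> * w x) + \<beta> * ((x\<^sup>2 - v\<^sup>2) * w x))
      (\<lambda>x. (f' x + \<alpha> * w' x) + \<beta> * (2 * x * w x + (x\<^sup>2 - v\<^sup>2) * w' x))"
    by (intro odd_poly.add odd_poly.scale odd_poly_even_mult f w)
  moreover have "(f v + \<alpha> * w v) + \<beta> * ((v\<^sup>2 - v\<^sup>2) * w v) = a v"
    using w(3) insert.prems(2) odd_poly_0[OF f(1)] odd_poly_0[OF w(1)] by (auto simp: \<alpha>_def)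
  moreover have "(f' v + \<alpha> * w' v) + \<beta> * (2 * v * w v + (v\<^sup>2 - v\<^sup>2) * w' v) = b v"
    using w(3) by (auto simp: \<alpha>_def \<beta>_def)
  ultimately have "\<forall>u\<in>insert v S. (f u + \<alpha> * w u) + \<beta> * ((u\<^sup>2 - v\<^sup>2) * w u) = a u \<and>
      (f' u + \<alpha> * w' u) + \<beta> * (2 * u * w u + (u\<^sup>2 - v\<^sup>2) * w' u) = b u"
    using f(2) w(2) by simp
  with * show ?case by blast
qed

section \<open>Odd polynomials of rectangular matrices\<close>

text \<open>For odd \<open>f\<close> the second quotient is the divided difference between \<open>x\<close> and \<open>- y\<close>. The derivative \<open>f'\<close> is
  the value on the diagonal. These are the entries of \<open>E\<^sub>1\<close> and \<open>E\<^sub>2\<close> if \<open>f\<close> has the values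
  \<open>g\<^sub>i(s)\<close> and the derivatives \<open>\<eta>\<^sub>i\<close> at \<open>s\<^sub>i\<close>.\<close>

definition divided_difference :: "(real \<Rightarrow> real) \<Rightarrow> (real \<Rightarrow> real) \<Rightarrow> real \<Rightarrow> real \<Rightarrow> real" where
  "divided_difference f f' x y = (if x \<noteq> y then (f x - f y) / (x - y) else f' x)"

definition divided_sum :: "(real \<Rightarrow> real) \<Rightarrow> (real \<Rightarrow> real) \<Rightarrow> real \<Rightarrow> real \<Rightarrow> real" where
  "divided_sum f f' x y = (if x + y \<noteq> 0 then (f x + f y) / (x + y) else f' x)"

lemma divided_id: "divided_difference (\<lambda>x. x) (\<lambda>x. 1) x y = 1" "divided_sum (\<lambda>x. x) (\<lambda>x. 1) x y = 1"
  by (simp_all add: divided_difference_def divided_sum_def)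

lemma divided_add:
  "divided_difference (\<lambda>x. f x + h x) (\<lambda>x. f' x + h' x) x y = divided_difference f f' x y + divided_difference h h' x y"
  "divided_sum (\<lambda>x. f x + h x) (\<lambda>x. f' x + h' x) x y = divided_sum f f' x y + divided_sum h h' x y"
  by (simp_all add: divided_difference_def divided_sum_def add_divide_distrib[symmetric] algebra_simps)

lemma divided_scale:
  "divided_difference (\<lambda>x. c * f x) (\<lambda>x. c * f' x) x y = c * divided_difference f f' x y"
  "divided_sum (\<lambda>x. c * f x) (\<lambda>x. c * f' x) x y = c * divided_sum f f' x y"
  by (simp_all add: divided_difference_def divided_sum_def right_diff_distrib distrib_left)

lemma divided_square_mult:
  assumes "odd_poly f f'"
  shows "divided_difference (\<lambda>x. x\<^sup>2 * f x) (\<lambda>x. 2 * x * f x + x\<^sup>2 * f' x) x y = x\<^sup>2 * divided_difference f f' x y + (x + y) * f y"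
    and "divided_sum (\<lambda>x. x\<^sup>2 * f x) (\<lambda>x. 2 * x * f x + x\<^sup>2 * f' x) x y = x\<^sup>2 * divided_sum f f' x y + (y - x) * f y"
proof -
  show "divided_difference (\<lambda>x. x\<^sup>2 * f x) (\<lambda>x. 2 * x * f x + x\<^sup>2 * f' x) x y = x\<^sup>2 * divided_difference f f' x y + (x + y) * f y"
  proof (cases "x = y")
    case False
    have "x\<^sup>2 * f x - y\<^sup>2 * f y = x\<^sup>2 * (f x - f y) + (x + y) * f y * (x - y)"
      by (simp add: algebra_simps power2_eq_square)
    then show ?thesis using False by (simp add: divided_difference_def add_divide_distrib)
  qed (simp add: divided_difference_def)
  show "divided_sum (\<lambda>x. x\<^sup>2 * f x) (\<lambda>x. 2 * x * f x + x\<^sup>2 * f' x) x y = x\<^sup>2 * divided_sum f f' x y + (y - x) * f y"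
  proof (cases "x + y = 0")
    case True
    then have "y = - x" by simp
    then show ?thesis using odd_poly_minus[OF assms, of x] by (simp add: divided_sum_def)
  next
    case False
    have "x\<^sup>2 * f x + y\<^sup>2 * f y = x\<^sup>2 * (f x + f y) + (y - x) * f y * (x + y)"
      by (simp add: algebra_simps power2_eq_square)
    then show ?thesis using False by (simp add: divided_sum_def add_divide_distrib[of "x\<^sup>2 * (f x + f y)"])
  qed
qed

text \<open>The derivative at \<open>D\<^sub>s\<close>: on the first \<open>m\<close> columns it is \<open>E\<^sub>1 \<circ> S(K) + E\<^sub>2 \<circ> T(K)\<close>, expanded in \<open>K\<^sub>i\<^sub>j\<close> and
  \<open>conj(K\<^sub>j\<^sub>i)\<close>. On the other columns the second argument of the divided difference is zero, as if the singular
  values were continued by zeros.\<close>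

definition spectral_derivative :: "(real \<Rightarrow> real) \<Rightarrow> (real \<Rightarrow> real) \<Rightarrow> real^'m::{finite,linorder} \<Rightarrow>
    'a::real_or_complex^'n::{finite,linorder}^'m::_ \<Rightarrow> 'a^'n::_^'m::_" where
  "spectral_derivative f f' s K = blocks
     (\<chi> i j. ((divided_difference f f' (s $ i) (s $ j) + divided_sum f f' (s $ i) (s $ j)) / 2) *\<^sub>R K $ i $ lead j
           + ((divided_difference f f' (s $ i) (s $ j) - divided_sum f f' (s $ i) (s $ j)) / 2) *\<^sub>R conjugate (K $ j $ lead i))
     (\<chi> i l. divided_difference f f' (s $ i) 0 *\<^sub>R K $ i $ l)"

lemma spectral_derivative_nth:
  fixes s :: "real^'m::{finite,linorder}" and K :: "'a::real_or_complex^'n::{finite,linorder}^'m::_"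
  assumes mn: "CARD('m) \<le> CARD('n)"
  shows "spectral_derivative f f' s K $ i $ lead j =
      ((divided_difference f f' (s $ i) (s $ j) + divided_sum f f' (s $ i) (s $ j)) / 2) *\<^sub>R K $ i $ lead j
      + ((divided_difference f f' (s $ i) (s $ j) - divided_sum f f' (s $ i) (s $ j)) / 2) *\<^sub>R conjugate (K $ j $ lead i)"
    and "l \<notin> range (lead :: 'm \<Rightarrow> 'n) \<Longrightarrow> spectral_derivative f f' s K $ i $ l = divided_difference f f' (s $ i) 0 *\<^sub>R K $ i $ l"
  by (simp_all add: spectral_derivative_def blocks_lead[OF mn] blocks_not_lead)

lemma matrix_eq_leadI:
  fixes M N :: "'a^'n::{finite,linorder}^'p"
  assumes "\<And>i j. M $ i $ lead (j::'m::{finite,linorder}) = N $ i $ lead j"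
    and "\<And>i l. l \<notin> range (lead :: 'm \<Rightarrow> 'n) \<Longrightarrow> M $ i $ l = N $ i $ l"
  shows "M = N"
proof -
  have "M $ i $ l = N $ i $ l" for i l
    by (cases "l \<in> range (lead :: 'm \<Rightarrow> 'n)") (auto simp: assms)
  then show ?thesis by (simp add: vec_eq_iff)
qed

lemma adj_rdiag_mult:
  fixes x :: "real^'m::{finite,linorder}" and Z :: "'a::real_or_complex^'q^'m::_"
  assumes "CARD('m) \<le> CARD('n::{finite,linorder})"
  shows "(adj (rdiag x :: 'a^'n::_^'m::_) ** Z) $ lead i $ k = of_real (x $ i) * Z $ i $ k"
proof -
  have "(adj (rdiag x :: 'a^'n::_^'m::_)) $ lead i $ j * Z $ j $ k = (if j = i then of_real (x $ i) * Z $ i $ k else 0)" for j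
    using inj_eq[OF inj_lead[OF assms], of i j] by (auto simp: rdiag_nth[OF assms])
  then show ?thesis by (simp add: matrix_matrix_mult_def)
qed

lemma mult_adj_rdiag:
  fixes x :: "real^'m::{finite,linorder}" and Z :: "'a::real_or_complex^'n::{finite,linorder}^'p"
  assumes "CARD('m) \<le> CARD('n)"
  shows "(Z ** adj (rdiag x)) $ i $ k = Z $ i $ lead k * of_real (x $ k)"
proof -
  have "Z $ i $ l * adj (rdiag x) $ l $ k = (if l = lead k then Z $ i $ lead k * of_real (x $ k) else 0)" for l
    by (auto simp: rdiag_nth[OF assms])
  then show ?thesis by (simp add: matrix_matrix_mult_def)
qed

text \<open>
  Induction along the generation of \<open>f\<close>. In the last step \<open>F(Y)\<close> becomes \<open>Y Y\<^sup>* F(Y)\<close>, and the product rule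
  at \<open>D = D\<^sub>s\<close> yields \<open>D D\<^sup>* F'(D)H + D H\<^sup>* F(D) + H D\<^sup>* F(D)\<close>. Entrywise these three terms are the
  recursion of \<open>divided_square_mult\<close>.
\<close>

lemma odd_poly_matrix_at_rdiag:
  assumes mn: "CARD('m::{finite,linorder}) \<le> CARD('n::{finite,linorder})" and "odd_poly f f'"
  shows "\<exists>F :: 'a::real_or_complex^'n::_^'m::_ \<Rightarrow> 'a^'n::_^'m::_.
    (\<forall>P W t. P \<in> unitary_mats \<longrightarrow> W \<in> unitary_mats \<longrightarrow>
       F (P ** rdiag t ** adj W) = P ** rdiag (\<chi> i. f (t $ i)) ** adj W) \<and>
    (\<forall>s. (F has_derivative spectral_derivative f f' s) (at (rdiag s)))"
  using assms(2)
proof (induction rule: odd_poly.induct)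
  case id
  have "spectral_derivative (\<lambda>x. x) (\<lambda>x. 1) s = (\<lambda>H. H :: 'a^'n::_^'m::_)" for s :: "real^'m::_"
    by (rule ext, rule matrix_eq_leadI[where 'm='m]) (simp_all add: spectral_derivative_nth[OF mn] divided_id)
  then show ?case by (intro exI[of _ "\<lambda>Y. Y"]) simp
next
  case (add f f' h h')
  obtain F :: "'a^'n::_^'m::_ \<Rightarrow> 'a^'n::_^'m::_" where
    F: "\<And>P W t. P \<in> unitary_mats \<Longrightarrow> W \<in> unitary_mats \<Longrightarrow>
       F (P ** rdiag t ** adj W) = P ** rdiag (\<chi> i. f (t $ i)) ** adj W"
      "\<And>s. (F has_derivative spectral_derivative f f' s) (at (rdiag s))" using add.IH(1) by blast
  obtain G :: "'a^'n::_^'m::_ \<Rightarrow> 'a^'n::_^'m::_" where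
    G: "\<And>P W t. P \<in> unitary_mats \<Longrightarrow> W \<in> unitary_mats \<Longrightarrow>
       G (P ** rdiag t ** adj W) = P ** rdiag (\<chi> i. h (t $ i)) ** adj W"
      "\<And>s. (G has_derivative spectral_derivative h h' s) (at (rdiag s))" using add.IH(2) by blast
  have 1: "(\<chi> i. f (t $ i) + h (t $ i)) = (\<chi> i. f (t $ i)) + (\<chi> i. h (t $ i))" for t :: "real^'m::_"
    by (simp add: vec_eq_iff)
  have 2: "spectral_derivative (\<lambda>x. f x + h x) (\<lambda>x. f' x + h' x) s =
      (\<lambda>H :: 'a^'n::_^'m::_. spectral_derivative f f' s H + spectral_derivative h h' s H)" for s :: "real^'m::_"
    by (rule ext, rule matrix_eq_leadI[where 'm='m])
      (simp_all add: spectral_derivative_nth[OF mn] divided_add add_divide_distrib diff_divide_distrib algebra_simps)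
  show ?case
    unfolding 1 2 linear_add[OF linear_rdiag[OF mn]] matrix_add_ldistrib
      bounded_bilinear.add_left[OF bounded_bilinear_matrix_mult]
    by (intro exI[of _ "\<lambda>Y. F Y + G Y"]) (simp add: F G has_derivative_add)
next
  case (scale f f' c)
  obtain F :: "'a^'n::_^'m::_ \<Rightarrow> 'a^'n::_^'m::_" where
    F: "\<And>P W t. P \<in> unitary_mats \<Longrightarrow> W \<in> unitary_mats \<Longrightarrow>
       F (P ** rdiag t ** adj W) = P ** rdiag (\<chi> i. f (t $ i)) ** adj W"
      "\<And>s. (F has_derivative spectral_derivative f f' s) (at (rdiag s))" using scale.IH by blast
  have 1: "(\<chi> i. c * f (t $ i)) = c *\<^sub>R (\<chi> i. f (t $ i))" for t :: "real^'m::_"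
    by (simp add: vec_eq_iff)
  have 2: "spectral_derivative (\<lambda>x. c * f x) (\<lambda>x. c * f' x) s =
      (\<lambda>H :: 'a^'n::_^'m::_. c *\<^sub>R spectral_derivative f f' s H)" for s :: "real^'m::_"
    by (rule ext, rule matrix_eq_leadI[where 'm='m])
      (simp_all add: spectral_derivative_nth[OF mn] divided_scale algebra_simps)
  have 3: "P ** (c *\<^sub>R Z) ** adj W = c *\<^sub>R (P ** Z ** adj W)"
    for P :: "'a^'m::_^'m::_" and W :: "'a^'n::_^'n::_" and Z
    by (simp add: bounded_bilinear.scaleR_left[OF bounded_bilinear_matrix_mult]
        bounded_bilinear.scaleR_right[OF bounded_bilinear_matrix_mult])
  show ?case
    unfolding 1 2 linear_scale[OF linear_rdiag[OF mn]] 3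
    by (intro exI[of _ "\<lambda>Y. c *\<^sub>R F Y"]) (simp add: F has_derivative_scaleR_right)
next
  case (square_mult f f')
  obtain F :: "'a^'n::_^'m::_ \<Rightarrow> 'a^'n::_^'m::_" where
    F: "\<And>P W t. P \<in> unitary_mats \<Longrightarrow> W \<in> unitary_mats \<Longrightarrow>
       F (P ** rdiag t ** adj W) = P ** rdiag (\<chi> i. f (t $ i)) ** adj W"
      "\<And>s. (F has_derivative spectral_derivative f f' s) (at (rdiag s))" using square_mult.IH by blast
  let ?F = "\<lambda>Y. Y ** (adj Y ** F Y)"
  have Fd: "F (rdiag t) = rdiag (\<chi> i. f (t $ i))" for t
    using F(1)[OF unitary_mats_1 unitary_mats_1, of t] by simp
  have prod: "rdiag t ** (adj (rdiag t :: 'a^'n::_^'m::_) ** (rdiag u :: 'a^'n::_^'m::_)) = (rdiag (\<chi> i. (t $ i)\<^sup>2 * u $ i) :: 'a^'n::_^'m::_)"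
    for t u :: "real^'m::_"
    by (rule matrix_eq_leadI[where 'm='m])
      (simp_all add: Diag_block_mult[OF mn] adj_rdiag_mult[OF mn] rdiag_nth[OF mn] power2_eq_square)
  have "?F (P ** rdiag t ** adj W) = P ** rdiag (\<chi> i. (t $ i)\<^sup>2 * f (t $ i)) ** adj W"
    if PW: "P \<in> unitary_mats" "W \<in> unitary_mats" for P W t
  proof -
    have "?F (P ** rdiag t ** adj W) = P ** (rdiag t ** (adj (rdiag t :: 'a^'n::_^'m::_) ** rdiag (\<chi> i. f (t $ i)))) ** adj W"
      unfolding F(1)[OF PW]
      by (simp add: adj_matrix_mult matrix_mul_assoc[symmetric] unitary_matsD[OF PW(1)]
          unitary_matsD[OF PW(2)])
    then show ?thesis unfolding prod by simp
  qed
  moreover have "(?F has_derivative spectral_derivative (\<lambda>x. x\<^sup>2 * f x) (\<lambda>x. 2 * x * f x + x\<^sup>2 * f' x) s) (at (rdiag s))" for s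
  proof -
    let ?D = "rdiag s :: 'a^'n::_^'m::_" and ?E = "rdiag (\<chi> i. f (s $ i)) :: 'a^'n::_^'m::_"
    have "(?F has_derivative (\<lambda>H. ?D ** (adj ?D ** spectral_derivative f f' s H + adj H ** F ?D) + H ** (adj ?D ** F ?D))) (at ?D)"
      by (intro bounded_bilinear.FDERIV[OF bounded_bilinear_matrix_mult] has_derivative_ident F(2)
          bounded_linear.has_derivative[OF bounded_linear_adj])
    moreover have "?D ** (adj ?D ** spectral_derivative f f' s H + adj H ** F ?D) + H ** (adj ?D ** F ?D) =
        spectral_derivative (\<lambda>x. x\<^sup>2 * f x) (\<lambda>x. 2 * x * f x + x\<^sup>2 * f' x) s H" for H
    proof -
      have "?D ** (adj ?D ** spectral_derivative f f' s H + adj H ** ?E) + (H ** adj ?D) ** ?E =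
        spectral_derivative (\<lambda>x. x\<^sup>2 * f x) (\<lambda>x. 2 * x * f x + x\<^sup>2 * f' x) s H" (is "?l = ?r")
      proof (rule matrix_eq_leadI[where 'm='m])
        fix i and j :: 'm
        let ?a = "H $ i $ lead j" and ?b = "conjugate (H $ j $ lead i)"
        let ?x = "s $ i" and ?y = "s $ j"
        let ?d1 = "divided_difference f f' ?x ?y" and ?d2 = "divided_sum f f' ?x ?y"
        have "?l $ i $ lead j = of_real ?x * (of_real ?x * (((?d1 + ?d2) / 2) *\<^sub>R ?a + ((?d1 - ?d2) / 2) *\<^sub>R ?b)
            + ?b * of_real (f ?y)) + ?a * of_real ?y * of_real (f ?y)"
          by (simp add: Diag_block_mult[OF mn] adj_rdiag_mult[OF mn] mult_Diag_block[OF mn]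
              mult_adj_rdiag[OF mn] spectral_derivative_nth[OF mn])
        also have "\<dots> = (?x * ?x * ((?d1 + ?d2) / 2) + ?y * f ?y) *\<^sub>R ?a
            + (?x * ?x * ((?d1 - ?d2) / 2) + ?x * f ?y) *\<^sub>R ?b"
          by (simp add: scaleR_conv_of_real algebra_simps)
        also have "\<dots> = ?r $ i $ lead j"
          unfolding spectral_derivative_nth(1)[OF mn] divided_square_mult[OF square_mult.hyps]
          by (intro arg_cong2[of _ _ _ _ "(+)"] arg_cong2[of _ _ _ _ "(*\<^sub>R)"] refl)
            (simp_all add: field_simps power2_eq_square)
        finally show "?l $ i $ lead j = ?r $ i $ lead j" .
      next
        fix i l assume l: "l \<notin> range (lead :: 'm \<Rightarrow> 'n)"
        have "?l $ i $ l = of_real (s $ i) * (of_real (s $ i) * (divided_difference f f' (s $ i) 0 *\<^sub>R H $ i $ l))"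
          using l by (simp add: Diag_block_mult[OF mn] adj_rdiag_mult[OF mn] mult_Diag_block[OF mn]
              spectral_derivative_nth[OF mn])
        also have "\<dots> = ?r $ i $ l"
          unfolding spectral_derivative_nth(2)[OF mn l] divided_square_mult[OF square_mult.hyps] odd_poly_0[OF square_mult.hyps]
          by (simp add: scaleR_conv_of_real power2_eq_square mult_ac)
        finally show "?l $ i $ l = ?r $ i $ l" .
      qed
      then show ?thesis unfolding Fd by (simp only: matrix_mul_assoc)
    qed
    ultimately show ?thesis by (simp only: has_derivative_eq_rhs ext)
  qed
  ultimately show ?case by (intro exI[of _ ?F]) simp
qed

text \<open>A matrix function that acts on singular values is equivariant under \<open>Y \<mapsto> U Y V\<^sup>*\<close>, so the derivative at
  \<open>D\<^sub>s\<close> determines the derivative at \<open>U D\<^sub>s V\<^sup>*\<close>.\<close>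

lemma odd_poly_matrix:
  assumes mn: "CARD('m::{finite,linorder}) \<le> CARD('n::{finite,linorder})" and "odd_poly f f'"
  obtains F :: "'a::real_or_complex^'n::{finite,linorder}^'m::{finite,linorder} \<Rightarrow>
      'a^'n::{finite,linorder}^'m::{finite,linorder}" where
    "\<And>P W t. P \<in> unitary_mats \<Longrightarrow> W \<in> unitary_mats \<Longrightarrow>
       F (P ** rdiag t ** adj W) = P ** rdiag (\<chi> i. f (t $ i)) ** adj W"
    "\<And>U V s. U \<in> unitary_mats \<Longrightarrow> V \<in> unitary_mats \<Longrightarrow>
       (F has_derivative (\<lambda>H. U ** spectral_derivative f f' s (adj U ** H ** V) ** adj V))
         (at (U ** rdiag s ** adj V))"
proof -
  obtain F :: "'a^'n::_^'m::_ \<Rightarrow> 'a^'n::_^'m::_" where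
    F: "\<And>P W t. P \<in> unitary_mats \<Longrightarrow> W \<in> unitary_mats \<Longrightarrow>
       F (P ** rdiag t ** adj W) = P ** rdiag (\<chi> i. f (t $ i)) ** adj W"
      "\<And>s. (F has_derivative spectral_derivative f f' s) (at (rdiag s))"
    using odd_poly_matrix_at_rdiag[OF assms] by blast
  have "(F has_derivative (\<lambda>H. U ** spectral_derivative f f' s (adj U ** H ** V) ** adj V))
         (at (U ** rdiag s ** adj V))" if UV: "U \<in> unitary_mats" "V \<in> unitary_mats" for U V s
  proof -
    have equiv: "F Y = U ** F (adj U ** Y ** V) ** adj V" for Y
    proof -
      obtain P W where "is_svd Y P (singular_values Y) W" using svd_singular_values[OF mn] .
      then have PW: "P \<in> unitary_mats" "W \<in> unitary_mats"
        and Y: "Y = P ** rdiag (singular_values Y) ** adj W"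
        unfolding is_svd_def by blast+
      define t where "t = singular_values Y"
      have Y: "Y = P ** rdiag t ** adj W" using Y by (simp only: t_def)
      have "adj U ** Y ** V = (adj U ** P) ** rdiag t ** adj (adj V ** W)"
        unfolding Y by (simp add: adj_matrix_mult matrix_mul_assoc)
      then have "F (adj U ** Y ** V) = (adj U ** P) ** rdiag (\<chi> i. f (t $ i)) ** adj (adj V ** W)"
        by (simp only: F(1) unitary_mats_mult unitary_mats_adj UV PW)
      then have "U ** F (adj U ** Y ** V) ** adj V = P ** rdiag (\<chi> i. f (t $ i)) ** adj W"
        by (simp add: adj_matrix_mult matrix_mul_assoc[symmetric] unitary_matsD[OF UV(1)]
            unitary_matsD[OF UV(2)])
      also have "\<dots> = F Y" unfolding Y by (simp only: F(1)[OF PW])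
      finally show ?thesis by simp
    qed
    have D: "adj U ** (U ** rdiag s ** adj V) ** V = rdiag s"
      by (simp add: matrix_mul_assoc[symmetric] unitary_matsD[OF UV(1)] unitary_matsD[OF UV(2)])
    have lin: "bounded_linear (\<lambda>Y. adj U ** Y ** V)" "bounded_linear (\<lambda>Y. U ** Y ** adj V)"
      by (intro bounded_linear_compose[OF bounded_linear_matrix_mult_left bounded_linear_matrix_mult_right])+
    have "((\<lambda>Y. F (adj U ** Y ** V)) has_derivative (\<lambda>H. spectral_derivative f f' s (adj U ** H ** V)))
        (at (U ** rdiag s ** adj V))"
      by (rule has_derivative_compose[OF bounded_linear_imp_has_derivative[OF lin(1)]])
        (simp only: D F(2))
    then have "((\<lambda>Y. U ** F (adj U ** Y ** V) ** adj V) has_derivative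
        (\<lambda>H. U ** spectral_derivative f f' s (adj U ** H ** V) ** adj V)) (at (U ** rdiag s ** adj V))"
      by (rule bounded_linear.has_derivative[OF lin(2)])
    then show ?thesis by (simp only: equiv[symmetric])
  qed
  with F(1) that show ?thesis by blast
qed

section \<open>Symmetry of the Jacobian\<close>

lemma has_derivative_vecI:
  fixes f :: "'b::real_normed_vector \<Rightarrow> real^'m"
  assumes "\<And>i. ((\<lambda>x. f x $ i) has_derivative (\<lambda>h. f' h $ i)) F"
  shows "(f has_derivative f') F"
proof -
  have "((\<lambda>x. \<Sum>i\<in>UNIV. f x $ i *\<^sub>R axis i 1) has_derivative (\<lambda>h. \<Sum>i\<in>UNIV. f' h $ i *\<^sub>R axis i (1::real))) F"
    by (intro has_derivative_sum has_derivative_scaleR_left assms)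
  moreover have "(\<Sum>i\<in>UNIV. v $ i *\<^sub>R axis i (1::real)) = v" for v :: "real^'m"
    by (simp add: vec_eq_iff axis_def if_distrib[of "\<lambda>u. _ * u"] cong: if_cong)
  ultimately show ?thesis by simp
qed

lemma signed_permutation_matrix_mult:
  fixes t :: "'m::finite \<Rightarrow> 'm" and c :: "'m \<Rightarrow> real"
  defines "Q \<equiv> \<chi> a b. if b = t a then c a else 0"
  shows "(Q *v x) $ a = c a * x $ t a"
  by (simp add: Q_def matrix_vector_mult_def if_distrib[of "\<lambda>u. u * _"] cong: if_cong)

lemma signed_permutation_matrixI:
  fixes t :: "'m::finite \<Rightarrow> 'm" and c :: "'m \<Rightarrow> real"
  assumes "bij t" and c: "\<And>a. c a = 1 \<or> c a = -1"
  shows "signed_permutation_matrix (\<chi> a b. if b = t a then c a else 0)"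
proof -
  have c0: "c a \<noteq> 0" for a using c[of a] by auto
  have "\<exists>!a. b = t a" for b using assms(1) by (metis bij_pointE)
  then show ?thesis unfolding signed_permutation_matrix_def using c by (simp add: c0)
qed

lemma absolutely_symmetric_onD:
  fixes g :: "real^'m \<Rightarrow> real^'m"
  assumes "absolutely_symmetric_on D g" "x \<in> D" "bij t" "\<And>a. c a = 1 \<or> c a = -1"
  shows "g (\<chi> a. c a * x $ t a) = (\<chi> a. c a * g x $ t a)"
proof -
  define Q :: "real^'m^'m" where "Q = (\<chi> a b. if b = t a then c a else 0)"
  have *: "Q *v y = (\<chi> a. c a * y $ t a)" for y
    by (simp add: vec_eq_iff Q_def signed_permutation_matrix_mult)
  have "g (Q *v x) = Q *v g x"
    using assms signed_permutation_matrixI[OF assms(3,4)]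
    by (simp add: absolutely_symmetric_on_def Q_def)
  then show ?thesis by (simp only: *)
qed

lemma absolutely_symmetric_on_subset:
  "absolutely_symmetric_on D g \<Longrightarrow> E \<subseteq> D \<Longrightarrow> absolutely_symmetric_on E g"
  by (auto simp: absolutely_symmetric_on_def)

text \<open>Differentiating \<open>g(Q x) = Q g(x)\<close> at a fixed point \<open>s\<close> of \<open>Q\<close> gives \<open>J Q = Q J\<close>. Here \<open>Q\<close> exchanges the
  coordinates \<open>i\<close> and \<open>j\<close> and multiplies both by \<open>e\<close>; for \<open>i = j\<close> and \<open>e = -1\<close> it is the reflection of one
  coordinate.\<close>

lemma jacobian_signed_transposition:
  fixes g :: "real^'m \<Rightarrow> real^'m"
  assumes g: "absolutely_symmetric_on D g" and D: "open D" "s \<in> D"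
    and J: "(g has_derivative (\<lambda>h. J *v h)) (at s)"
    and e: "e = 1 \<or> e = -1" and ij: "s $ i = e * s $ j"
  shows "J $ a $ Transposition.transpose i j b * (if b = i \<or> b = j then e else 1) =
    (if a = i \<or> a = j then e else 1) * J $ Transposition.transpose i j a $ b"
proof -
  define t where "t = Transposition.transpose i j"
  define c where "c a = (if a = i \<or> a = j then e else 1)" for a
  define L where "L x = (\<chi> a. c a * x $ t a)" for x :: "real^'m"
  have c: "c a = 1 \<or> c a = -1" for a using e by (auto simp: c_def)
  have t: "bij t" "\<And>a. t (t a) = a" by (simp_all add: t_def)
  have "e * e = 1" using e by auto
  then have ji: "e * s $ i = s $ j" unfolding ij by (simp add: mult.assoc[symmetric])
  have "c a * s $ t a = s $ a" for a
    unfolding c_def t_def Transposition.transpose_def using ji ij[symmetric] by (simp only: if_distrib) simp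
  then have Ls: "L s = s" by (simp add: L_def vec_eq_iff)
  have lin: "bounded_linear L"
    unfolding linear_conv_bounded_linear[symmetric]
    by (rule linearI) (simp_all add: L_def vec_eq_iff algebra_simps)
  have "((\<lambda>x. g (L x)) has_derivative (\<lambda>h. J *v L h)) (at s)"
    by (rule has_derivative_compose[OF bounded_linear_imp_has_derivative[OF lin]]) (simp add: Ls J)
  moreover have "((\<lambda>x. L (g x)) has_derivative (\<lambda>h. L (J *v h))) (at s)"
    by (rule bounded_linear.has_derivative[OF lin J])
  then have "((\<lambda>x. g (L x)) has_derivative (\<lambda>h. L (J *v h))) (at s)"
    by (rule has_derivative_transform_within_open[OF _ D])
      (simp add: L_def absolutely_symmetric_onD[OF g _ t(1) c])
  ultimately have "(\<lambda>h. J *v L h) = (\<lambda>h. L (J *v h))" by (rule has_derivative_unique)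
  then have eq: "J *v L (axis b 1) = L (J *v axis b 1)" by (rule fun_cong)
  have "L (axis b 1) = c (t b) *\<^sub>R axis (t b) 1"
    using t(2) by (auto simp: L_def vec_eq_iff axis_def)
  then have "c (t b) *\<^sub>R (J *v axis (t b) 1) = L (J *v axis b 1)"
    using eq by (simp add: matrix_vector_mult_scaleR)
  from arg_cong[OF this, of "\<lambda>v. v $ a"] have "c (t b) * J $ a $ t b = c a * J $ t a $ b"
    by (simp add: L_def matrix_vector_mult_basis column_def)
  moreover have "c (t b) = c b" by (auto simp: c_def t_def Transposition.transpose_def)
  ultimately show ?thesis unfolding t_def c_def by (simp only: mult.commute)
qed

context
  fixes g :: "real^'m \<Rightarrow> real^'m" and D and s :: "real^'m"
  assumes g: "absolutely_symmetric_on D g" and D: "open D" "s \<in> D"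
    and diff: "g differentiable (at s)"
begin

lemma has_derivative_jacobian: "(g has_derivative (\<lambda>h. jacobian g (at s) *v h)) (at s)"
  using diff jacobian_works by blast

lemma jacobian_transposition:
  assumes "s $ i = s $ j"
  shows "jacobian g (at s) $ a $ b =
    jacobian g (at s) $ Transposition.transpose i j a $ Transposition.transpose i j b"
  using jacobian_signed_transposition[OF g D has_derivative_jacobian, of 1 i j a
      "Transposition.transpose i j b"] assms by simp

lemma jacobian_off_diagonal_zero:
  assumes "s $ k = 0" "i \<noteq> j" "k = i \<or> k = j"
  shows "jacobian g (at s) $ i $ j = 0"
  using jacobian_signed_transposition[OF g D has_derivative_jacobian, of "-1" k k i j] assms by auto

lemma eta_eq:
  assumes "j \<noteq> i" "s $ i = s $ j"
  shows "eta g s $ i = jacobian g (at s) $ i $ i - jacobian g (at s) $ i $ j"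
proof -
  define k where "k = (SOME j. j \<noteq> i \<and> s $ i = s $ j)"
  have ex: "\<exists>j. j \<noteq> i \<and> s $ i = s $ j" using assms by blast
  have k: "k \<noteq> i" "s $ i = s $ k" using someI_ex[OF ex] by (simp_all add: k_def)
  have "jacobian g (at s) $ i $ k = jacobian g (at s) $ i $ j"
    using jacobian_transposition[of k j i k] k assms by (cases "k = j") auto
  then show ?thesis using ex unfolding eta_def k_def by (simp add: Let_def)
qed

lemma eta_distinct: "\<not> (\<exists>j. j \<noteq> i \<and> s $ i = s $ j) \<Longrightarrow> eta g s $ i = jacobian g (at s) $ i $ i"
  by (auto simp: eta_def Let_def)

lemma jacobian_block_sym:
  assumes "s $ i = s $ j"
  shows "jacobian g (at s) $ i $ i = jacobian g (at s) $ j $ j"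
    and "jacobian g (at s) $ i $ j = jacobian g (at s) $ j $ i"
  using jacobian_transposition[OF assms, of i i] jacobian_transposition[OF assms, of i j] by simp_all

lemma eta_cong:
  assumes "s $ i = s $ j"
  shows "eta g s $ i = eta g s $ j"
  using eta_eq[of j i] eta_eq[of i j] jacobian_block_sym[OF assms] assms by (cases "i = j") auto

lemma eta_zero:
  assumes "s $ i = 0"
  shows "eta g s $ i = jacobian g (at s) $ i $ i"
  using eta_eq[of _ i] eta_distinct[of i] jacobian_off_diagonal_zero[OF assms, of i]
  by (metis diff_zero)

lemma C_mat_nth: "C_mat g s $ i $ j = jacobian g (at s) $ i $ j - (if i = j then eta g s $ i else 0)"
  by (simp add: C_mat_def Diag_mat_def)

lemma C_mat_diag:
  assumes "j \<noteq> i" "s $ i = s $ j"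
  shows "C_mat g s $ i $ i = jacobian g (at s) $ i $ j"
  by (simp add: C_mat_nth eta_eq[OF assms])

text \<open>Off the diagonal \<open>C\<close> is the Jacobian, which is invariant under exchanging equal coordinates. On the
  diagonal, subtracting \<open>\<eta>\<close> replaces the entry by the common off-diagonal entry of its block, if the block has
  more than one index.\<close>

lemma C_mat_cong_col:
  assumes "s $ j = s $ k"
  shows "C_mat g s $ i $ j = C_mat g s $ i $ k"
proof -
  consider "j = k" | "j \<noteq> k" "i = j" | "j \<noteq> k" "i = k" | "i \<noteq> j" "i \<noteq> k" by blast
  then show ?thesis
  proof cases
    case 2
    then show ?thesis using C_mat_diag[of k j] assms by (simp add: C_mat_nth)
  next
    case 3
    then show ?thesis using C_mat_diag[of j k] assms by (simp add: C_mat_nth)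
  next
    case 4
    then show ?thesis using jacobian_transposition[OF assms, of i j] by (simp add: C_mat_nth)
  qed simp
qed

lemma C_mat_cong_row:
  assumes "s $ i = s $ k"
  shows "C_mat g s $ i $ j = C_mat g s $ k $ j"
proof -
  consider "i = k" | "i \<noteq> k" "j = i" | "i \<noteq> k" "j = k" | "j \<noteq> i" "j \<noteq> k" by blast
  then show ?thesis
  proof cases
    case 2
    then show ?thesis
      using C_mat_diag[of k i] jacobian_block_sym(2)[OF assms] assms by (simp add: C_mat_nth)
  next
    case 3
    then show ?thesis
      using C_mat_diag[of i k] jacobian_block_sym(2)[OF assms] assms by (simp add: C_mat_nth)
  next
    case 4
    then show ?thesis using jacobian_transposition[OF assms, of i j] by (simp add: C_mat_nth)
  qed simp
qed

lemma C_mat_zero: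
  assumes "s $ k = 0" "k = i \<or> k = j"
  shows "C_mat g s $ i $ j = 0"
  using jacobian_off_diagonal_zero[OF assms(1), of i j] eta_zero[of i] assms
  by (auto simp: C_mat_nth)

end

text \<open>Data indexed by the coordinates can be interpolated at the values of \<open>s\<close> if it depends only on these values;
  an odd polynomial moreover vanishes at zero.\<close>

lemma odd_interpolation_of_entries:
  fixes s :: "real^'m"
  assumes "\<And>i. 0 \<le> s $ i"
    and "\<And>i j. s $ i = s $ j \<Longrightarrow> x i = x j" "\<And>i j. s $ i = s $ j \<Longrightarrow> y i = y j"
    and "\<And>i. s $ i = 0 \<Longrightarrow> x i = 0"
  shows "\<exists>f f'. odd_poly f f' \<and> (\<forall>i. f (s $ i) = x i \<and> f' (s $ i) = y i)"
proof -
  define k where "k v = (SOME i. s $ i = v)" for v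
  have k: "s $ k (s $ i) = s $ i" for i
    unfolding k_def by (rule someI) simp
  have "\<exists>f f'. odd_poly f f' \<and> (\<forall>v\<in>range (($) s). f v = x (k v) \<and> f' v = y (k v))"
  proof (rule odd_hermite_interpolation)
    assume "0 \<in> range (($) s)"
    then obtain i where "s $ i = 0" by auto
    with k[of i] have "s $ k 0 = 0" by simp
    then show "x (k 0) = 0" by (rule assms(4))
  qed (use assms(1) in auto)
  then obtain f f' where "odd_poly f f'" "\<And>i. f (s $ i) = x (k (s $ i)) \<and> f' (s $ i) = y (k (s $ i))"
    by auto
  then show ?thesis using assms(2,3)[OF k] by auto
qed

section \<open>Spectral operators in fixed frames\<close>

lemma spectral_operator_svd:
  fixes Y :: "'a::real_or_complex^'n::{finite,linorder}^'m::{finite,linorder}"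
  assumes mn: "CARD('m) \<le> CARD('n)" and g: "absolutely_symmetric_on D g" and "singular_values Y \<in> D"
  obtains P W where "P \<in> unitary_mats" "W \<in> unitary_mats"
    "Y = P ** rdiag (singular_values Y) ** adj W"
    "spectral_operator g Y = P ** rdiag (g (singular_values Y)) ** adj W"
proof -
  obtain P W where PW: "is_svd Y P (singular_values Y) W" using svd_singular_values[OF mn] .
  have "spectral_operator g Y = P ** rdiag (g (singular_values Y)) ** adj W"
    by (rule spectral_operator_eq[OF mn _ PW]) (rule absolutely_symmetric_on_subset[OF g], use assms(3) in simp)
  with PW that show ?thesis unfolding is_svd_def by blast
qed

text \<open>
  The frames \<open>U\<close>, \<open>V\<close> do not sort \<open>x\<close>, so this is not the definition of the spectral operator. Replacing
  \<open>g\<close> by an odd polynomial that agrees with it at the sorted vector \<open>s\<close> avoids comparing the two pairs of frames: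
  the polynomial of the matrix can be evaluated in either of them.
\<close>

lemma spectral_operator_rdiag:
  fixes U :: "'a::real_or_complex^'m::{finite,linorder}^'m::_" and V :: "'a^'n::{finite,linorder}^'n::_"
  assumes mn: "CARD('m) \<le> CARD('n)" and g: "absolutely_symmetric_on D g"
    and UV: "U \<in> unitary_mats" "V \<in> unitary_mats"
    and D: "singular_values (U ** rdiag x ** adj V) \<in> D"
  shows "spectral_operator g (U ** rdiag x ** adj V) = U ** rdiag (g x) ** adj V"
proof -
  let ?Y = "U ** rdiag x ** adj V"
  obtain \<pi> and s :: "real^'m::_" where \<pi>: "bij \<pi>" and s: "nonneg_decreasing s" and x: "\<And>i. \<bar>x $ i\<bar> = s $ \<pi> i"
    using exists_decreasing_rearrangement[of x] by blast
  have \<sigma>: "singular_values ?Y = s" by (rule singular_values_signed_permutation[OF mn UV s \<pi> x])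
  have sD: "s \<in> D" using D \<sigma> by simp
  have gs: "absolutely_symmetric_on {s} g" by (rule absolutely_symmetric_on_subset[OF g]) (use sD in simp)
  have "\<exists>f f'. odd_poly f f' \<and> (\<forall>i. f (s $ i) = g s $ i \<and> f' (s $ i) = 0)"
  proof (rule odd_interpolation_of_entries)
    show "0 \<le> s $ i" for i using s by (simp add: nonneg_decreasing_def)
    show "g s $ i = g s $ j" if "s $ i = s $ j" for i j
      using absolutely_symmetric_component[OF gs, of 1 i j] that by simp
    show "g s $ i = 0" if "s $ i = 0" for i
      using absolutely_symmetric_component[OF gs, of "-1" i i] that by simp
  qed simp
  then obtain f f' where f: "odd_poly f f'" "\<And>i. f (s $ i) = g s $ i" by blast
  obtain F :: "'a^'n::_^'m::_ \<Rightarrow> 'a^'n::_^'m::_" where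
    F: "\<And>P W t. P \<in> unitary_mats \<Longrightarrow> W \<in> unitary_mats \<Longrightarrow>
       F (P ** rdiag t ** adj W) = P ** rdiag (\<chi> i. f (t $ i)) ** adj W"
    by (rule odd_poly_matrix[OF mn f(1)]) blast
  obtain P W where PW: "P \<in> unitary_mats" "W \<in> unitary_mats"
    and Y: "?Y = P ** rdiag s ** adj W" "spectral_operator g ?Y = P ** rdiag (g s) ** adj W"
    using spectral_operator_svd[OF mn g D] unfolding \<sigma> by blast
  have "(\<chi> i. f (s $ i)) = g s" by (simp add: vec_eq_iff f(2))
  then have "spectral_operator g ?Y = F ?Y" unfolding Y(2) using F[OF PW, of s] by (simp only: Y(1))
  also have "\<dots> = U ** rdiag (\<chi> i. f (x $ i)) ** adj V" by (rule F[OF UV])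
  also have "(\<chi> i. f (x $ i)) = g x"
  proof -
    define e where "e i = (if 0 \<le> x $ i then 1 else -1 :: real)" for i
    have xe: "x = (\<chi> i. e i * s $ \<pi> i)" by (simp add: vec_eq_iff e_def x[symmetric])
    have "g x = (\<chi> i. e i * g s $ \<pi> i)"
      by (subst xe) (rule absolutely_symmetric_onD[OF g sD \<pi>], simp add: e_def)
    moreover have "f (e i * s $ \<pi> i) = e i * g s $ \<pi> i" for i
      using odd_poly_minus[OF f(1), of "s $ \<pi> i"] by (simp add: e_def f(2))
    ultimately show ?thesis by (subst xe) (simp add: vec_eq_iff)
  qed
  finally show ?thesis .
qed

section \<open>Differentiability of spectral operators\<close>

text \<open>The matrices of the theorem against the derivative of the interpolating polynomial \<open>f\<close>. In \<open>E\<^sub>2\<close> and \<open>F\<close>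
  the exceptional value is \<open>J\<^sub>i\<^sub>i\<close> instead of \<open>\<eta>\<^sub>i\<close>; they agree because this case occurs only for \<open>s\<^sub>i = 0\<close>.\<close>

lemma spectral_derivative_formula:
  fixes U :: "'a::real_or_complex^'m::{finite,linorder}^'m::_" and V :: "'a^'n::{finite,linorder}^'n::_"
    and V1 :: "'a^'m::_^'n::_" and V2 :: "'a^'n::_^'n::_" and g :: "real^'m::_ \<Rightarrow> real^'m::_"
    and H :: "'a^'n::_^'m::_"
  assumes mn: "CARD('m) \<le> CARD('n)" and V: "V = blocks V1 V2"
    and s: "\<And>i. 0 \<le> s $ i" and f: "odd_poly f f'" "\<And>i. f (s $ i) = g s $ i" "\<And>i. f' (s $ i) = eta g s $ i"
    and eta0: "\<And>i. s $ i = 0 \<Longrightarrow> eta g s $ i = jacobian g (at s) $ i $ i"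
  defines "K \<equiv> adj U ** H ** V" and "A \<equiv> adj U ** H ** V1" and "B \<equiv> adj U ** H ** V2"
  shows "blocks (E1_mat g s \<odot> S_part A
           + Diag_mat (map_matrix of_real (C_mat g s) *v diag_vec (S_part A))
           + E2_mat g s \<odot> T_part A) (F_mat g s \<odot> B) =
         spectral_derivative f f' s K + rdiag (\<chi> i. \<Sum>k\<in>UNIV. C_mat g s $ i $ k * (1 \<bullet> K $ k $ lead k))"
    (is "?l = ?r")
proof (rule matrix_eq_leadI[where 'm='m])
  have KA: "K $ i $ lead j = A $ i $ j" for i j
    by (simp add: K_def A_def matrix_matrix_mult_def V blocks_lead[OF mn])
  have e1: "E1_mat g s $ i $ j = divided_difference f f' (s $ i) (s $ j)" for i j
    unfolding E1_mat_def divided_difference_def f(2,3)[symmetric] by simp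
  have e2: "E2_mat g s $ i $ j = divided_sum f f' (s $ i) (s $ j)" for i j
  proof (cases "s $ i + s $ j = 0")
    case True
    then have "s $ i = 0" using s[of i] s[of j] by simp
    then show ?thesis using True eta0[of i] f(3)[of i] by (simp add: E2_mat_def divided_sum_def)
  qed (simp add: E2_mat_def divided_sum_def f)
  have re: "(1/2) *\<^sub>R (y + conjugate y) = of_real (1 \<bullet> y)" for y :: 'a
    unfolding of_real_inner_scalar by (simp add: scaleR_conv_of_real)
  have S_nth: "S_part A $ i $ j = (1/2) *\<^sub>R (A $ i $ j + conjugate (A $ j $ i))"
    and T_nth: "T_part A $ i $ j = (1/2) *\<^sub>R (A $ i $ j - conjugate (A $ j $ i))" for i j
    by (simp_all add: S_part_def T_part_def)
  have had: "(E \<odot> Y) $ i $ j = E $ i $ j *\<^sub>R Y $ i $ j" for E :: "real^'m::_^'m::_" and Y :: "'a^'m::_^'m::_" and i j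
    by (simp add: hadamard_def scaleR_conv_of_real)
  have S: "diag_vec (S_part A) $ k = of_real (1 \<bullet> K $ k $ lead k)" for k
    unfolding KA re[symmetric] by (simp add: diag_vec_def S_part_def)
  have dia: "Diag_mat (map_matrix of_real (C_mat g s) *v diag_vec (S_part A)) $ i $ j =
      (if i = j then of_real (\<Sum>k\<in>UNIV. C_mat g s $ i $ k * (1 \<bullet> K $ k $ lead k)) else 0)" for i j
    by (simp add: Diag_mat_def matrix_vector_mult_def S)
  fix i and j :: 'm
  let ?d1 = "divided_difference f f' (s $ i) (s $ j)" and ?d2 = "divided_sum f f' (s $ i) (s $ j)"
  have eq: "?d1 *\<^sub>R ((1/2) *\<^sub>R (A $ i $ j + conjugate (A $ j $ i))) + ?d2 *\<^sub>R ((1/2) *\<^sub>R (A $ i $ j - conjugate (A $ j $ i)))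
      = ((?d1 + ?d2) / 2) *\<^sub>R A $ i $ j + ((?d1 - ?d2) / 2) *\<^sub>R conjugate (A $ j $ i)"
    by (simp add: algebra_simps add_divide_distrib diff_divide_distrib)
  have rdg: "(real_Diag v :: 'a^'m::_^'m::_) $ i $ j = (if i = j then of_real (v $ i) else 0)" for v :: "real^'m::_"
    by (simp add: real_Diag_def Diag_mat_def)
  show "?l $ i $ lead j = ?r $ i $ lead j"
    unfolding vector_add_component rdg blocks_lead[OF mn] spectral_derivative_nth(1)[OF mn] KA dia had
      S_nth T_nth e1 e2 eq[symmetric] vec_lambda_beta
    by (simp only: add_ac)
next
  fix i l assume l: "l \<notin> range (lead :: 'm \<Rightarrow> 'n)"
  have "K $ i $ l = B $ i $ l"
    by (simp add: K_def B_def matrix_matrix_mult_def V blocks_not_lead[OF l])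
  moreover have "F_mat g s $ i $ l = divided_difference f f' (s $ i) 0"
    using eta0[of i] f(3)[of i] by (cases "s $ i = 0") (simp_all add: F_mat_def divided_difference_def f(2) odd_poly_0[OF f(1)])
  moreover have "l \<noteq> lead i" using l by blast
  ultimately show "?l $ i $ l = ?r $ i $ l"
    unfolding vector_add_component blocks_not_lead[OF l] spectral_derivative_nth(2)[OF mn l] hadamard_def
    by (simp add: scaleR_conv_of_real)
qed

text \<open>\<open>G - \<Phi>\<close> has derivative zero by Mirsky's inequality, and \<open>\<Phi>\<close> is differentiated by the product rule. The
  derivatives of \<open>r\<^sub>j\<close> do not contribute, because they are multiplied by \<open>\<tau>\<^sub>j(s) - \<tau>\<^sub>j(s) = 0\<close>.\<close>

lemma spectral_operator_has_derivative:
  fixes X :: "'a::real_or_complex^'n::{finite,linorder}^'m::{finite,linorder}"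
    and g :: "real^'m::_ \<Rightarrow> real^'m::_" and G :: "'a^'n::_^'m::_ \<Rightarrow> 'a^'n::_^'m::_"
    and U :: "'a^'m::_^'m::_" and V :: "'a^'n::_^'n::_" and V1 :: "'a^'m::_^'n::_" and V2 :: "'a^'n::_^'n::_"
  defines "s \<equiv> singular_values X"
  assumes mn: "CARD('m) \<le> CARD('n)" and N: "open N" "X \<in> N" and D: "open D" "singular_values ` N \<subseteq> D"
    and g: "absolutely_symmetric_on D g" and G: "\<And>Y. Y \<in> N \<Longrightarrow> G Y = spectral_operator g Y"
    and UV: "U \<in> unitary_mats" "V \<in> unitary_mats" and X: "X = U ** rdiag s ** adj V" and V: "V = blocks V1 V2"
    and diff: "g differentiable (at s)"
  shows "(G has_derivative (\<lambda>H. let A = adj U ** H ** V1; B = adj U ** H ** V2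
      in U ** blocks (E1_mat g s \<odot> S_part A
                   + Diag_mat (map_matrix of_real (C_mat g s) *v diag_vec (S_part A))
                   + E2_mat g s \<odot> T_part A) (F_mat g s \<odot> B) ** adj V)) (at X)"
    (is "(G has_derivative ?DG) _")
proof -
  have s_nd: "nonneg_decreasing s" unfolding s_def by (rule nonneg_decreasing_singular_values[OF mn])
  have s0: "0 \<le> s $ i" for i using s_nd by (simp add: nonneg_decreasing_def)
  have sD: "s \<in> D" using N(2) D(2) unfolding s_def by blast
  have gs: "absolutely_symmetric_on {s} g" by (rule absolutely_symmetric_on_subset[OF g]) (use sD in simp)
  note sym = g D(1) sD diff
  define J where "J = jacobian g (at s)"
  define C where "C = C_mat g s"
  have C_nth: "C $ i $ j = J $ i $ j - (if i = j then eta g s $ i else 0)" for i j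
    unfolding C_def J_def by (rule C_mat_nth[OF sym])
  have "\<exists>p p'. odd_poly p p' \<and> (\<forall>i. p (s $ i) = g s $ i \<and> p' (s $ i) = eta g s $ i)"
  proof (rule odd_interpolation_of_entries[OF s0])
    show "g s $ i = g s $ j" if "s $ i = s $ j" for i j
      using absolutely_symmetric_component[OF gs, of 1 i j] that by simp
    show "eta g s $ i = eta g s $ j" if "s $ i = s $ j" for i j
      by (rule eta_cong[OF sym that])
    show "g s $ i = 0" if "s $ i = 0" for i
      using absolutely_symmetric_component[OF gs, of "-1" i i] that by simp
  qed
  then obtain p p' where p: "odd_poly p p'" "\<And>i. p (s $ i) = g s $ i" "\<And>i. p' (s $ i) = eta g s $ i" by blast
  have "\<exists>f f'. odd_poly f f' \<and> (\<forall>i. f (s $ i) = C $ i $ j \<and> f' (s $ i) = 0)" for j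
  proof (rule odd_interpolation_of_entries[OF s0])
    show "C $ i $ j = C $ k $ j" if "s $ i = s $ k" for i k
      unfolding C_def by (rule C_mat_cong_row[OF sym that])
    show "C $ i $ j = 0" if "s $ i = 0" for i
      unfolding C_def by (rule C_mat_zero[OF sym that]) simp
  qed simp
  then obtain r r' where r: "\<And>j. odd_poly (r j) (r' j)" "\<And>i j. r j (s $ i) = C $ i $ j" by metis
  \<comment> \<open>Each block of equal entries of \<open>s\<close> is represented by one index, and \<open>I j\<close> is the indicator of the
    block represented by \<open>j\<close>. It is zero on the block of zeros, where an odd polynomial cannot be one;
    nothing is lost, since the columns of \<open>C\<close> vanish there.\<close>
  define rep where "rep v = (SOME k. s $ k = v)" for v
  have rep: "s $ rep (s $ k) = s $ k" for k unfolding rep_def by (rule someI) simp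
  define I where "I j k = (if s $ k \<noteq> 0 \<and> rep (s $ k) = j then 1 else 0 :: real)" for j k
  have "\<exists>f f'. odd_poly f f' \<and> (\<forall>k. f (s $ k) = I j k \<and> f' (s $ k) = 0)" for j
    by (rule odd_interpolation_of_entries[OF s0]) (auto simp: I_def)
  then obtain q q' where q: "\<And>j. odd_poly (q j) (q' j)" "\<And>j k. q j (s $ k) = I j k" "\<And>j k. q' j (s $ k) = 0"
    by metis
  \<comment> \<open>Summing over blocks and weighting by the columns of \<open>C\<close> at their representatives recovers \<open>C v\<close>.\<close>
  have IC: "(\<Sum>j\<in>UNIV. (\<Sum>k\<in>UNIV. I j k * v k) * C $ i $ j) = (\<Sum>k\<in>UNIV. C $ i $ k * v k)" for v i
  proof -
    have "(\<Sum>j\<in>UNIV. I j k * v k * C $ i $ j) = C $ i $ k * v k" for k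
    proof (cases "s $ k = 0")
      case True
      then show ?thesis using C_mat_zero[OF sym True, of i k] by (simp add: I_def C_def)
    next
      case False
      have "I j k * v k * C $ i $ j = (if j = rep (s $ k) then v k * C $ i $ rep (s $ k) else 0)" for j
        using False by (simp add: I_def)
      then show ?thesis using C_mat_cong_col[OF sym rep, of i k] by (simp add: C_def mult.commute)
    qed
    then show ?thesis by (simp add: sum_distrib_right) (subst sum.swap, simp)
  qed
  obtain P :: "'a^'n::_^'m::_ \<Rightarrow> 'a^'n::_^'m::_" where
    P: "\<And>Q W t. Q \<in> unitary_mats \<Longrightarrow> W \<in> unitary_mats \<Longrightarrow>
        P (Q ** rdiag t ** adj W) = Q ** rdiag (\<chi> i. p (t $ i)) ** adj W"
      "\<And>U V s. U \<in> unitary_mats \<Longrightarrow> V \<in> unitary_mats \<Longrightarrow>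
       (P has_derivative (\<lambda>H. U ** spectral_derivative p p' s (adj U ** H ** V) ** adj V))
         (at (U ** rdiag s ** adj V))"
    by (rule odd_poly_matrix[OF mn p(1)]) blast
  have "\<exists>F :: 'a^'n::_^'m::_ \<Rightarrow> 'a^'n::_^'m::_.
    (\<forall>Q W t. Q \<in> unitary_mats \<longrightarrow> W \<in> unitary_mats \<longrightarrow>
       F (Q ** rdiag t ** adj W) = Q ** rdiag (\<chi> i. f (t $ i)) ** adj W) \<and>
    (F has_derivative (\<lambda>H. U ** spectral_derivative f f' s (adj U ** H ** V) ** adj V)) (at X)"
    if f: "odd_poly f f'" for f f'
  proof -
    obtain F :: "'a^'n::_^'m::_ \<Rightarrow> 'a^'n::_^'m::_" where
      F: "\<And>Q W t. Q \<in> unitary_mats \<Longrightarrow> W \<in> unitary_mats \<Longrightarrow>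
          F (Q ** rdiag t ** adj W) = Q ** rdiag (\<chi> i. f (t $ i)) ** adj W"
        "\<And>U V s. U \<in> unitary_mats \<Longrightarrow> V \<in> unitary_mats \<Longrightarrow>
          (F has_derivative (\<lambda>H. U ** spectral_derivative f f' s (adj U ** H ** V) ** adj V))
            (at (U ** rdiag s ** adj V))"
      by (rule odd_poly_matrix[OF mn f]) blast
    from F(1) F(2)[OF UV, of s, folded X] show ?thesis by blast
  qed
  note ex = this
  obtain R where
    R: "\<And>j Q W t. Q \<in> unitary_mats \<Longrightarrow> W \<in> unitary_mats \<Longrightarrow>
       R j (Q ** rdiag t ** adj W) = (Q ** rdiag (\<chi> i. r j (t $ i)) ** adj W :: 'a^'n::_^'m::_)"
      "\<And>j. (R j has_derivative (\<lambda>H. U ** spectral_derivative (r j) (r' j) s (adj U ** H ** V) ** adj V)) (at X)"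
    using ex[OF r(1)] by metis
  obtain T where
    T: "\<And>j Q W t. Q \<in> unitary_mats \<Longrightarrow> W \<in> unitary_mats \<Longrightarrow>
       T j (Q ** rdiag t ** adj W) = (Q ** rdiag (\<chi> i. q j (t $ i)) ** adj W :: 'a^'n::_^'m::_)"
      "\<And>j. (T j has_derivative (\<lambda>H. U ** spectral_derivative (q j) (q' j) s (adj U ** H ** V) ** adj V)) (at X)"
    using ex[OF q(1)] by metis
  define \<tau> where "\<tau> j t = (\<Sum>k\<in>UNIV. t $ k * q j (t $ k))" for j and t :: "real^'m::_"
  define \<phi> where "\<phi> t = (\<chi> i. p (t $ i) + (\<Sum>j\<in>UNIV. (\<tau> j t - \<tau> j s) * r j (t $ i)))" for t :: "real^'m::_"
  define \<Phi> where "\<Phi> Y = P Y + (\<Sum>j\<in>UNIV. (Y \<bullet> T j Y - X \<bullet> T j X) *\<^sub>R R j Y)" for Y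
  have tau: "(Q ** rdiag t ** adj W) \<bullet> T j (Q ** rdiag t ** adj W) = \<tau> j t"
    if "Q \<in> unitary_mats" "W \<in> unitary_mats" for Q W j t
    unfolding T(1)[OF that] inner_unitary[OF that] inner_rdiag_rdiag[OF mn]
    by (simp add: \<tau>_def inner_vec_def)
  have Phi: "\<Phi> (Q ** rdiag t ** adj W) = Q ** rdiag (\<phi> t) ** adj W"
    if QW: "Q \<in> unitary_mats" "W \<in> unitary_mats" for Q W t
  proof -
    have lin: "linear (\<lambda>x. Q ** rdiag x ** adj W :: 'a^'n::_^'m::_)"
      unfolding linear_conv_bounded_linear
      by (intro bounded_linear_compose[OF bounded_linear_matrix_mult_left]
          bounded_linear_compose[OF bounded_linear_matrix_mult_right] bounded_linear_rdiag[OF mn])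
    have "\<phi> t = (\<chi> i. p (t $ i)) + (\<Sum>j\<in>UNIV. (\<tau> j t - \<tau> j s) *\<^sub>R (\<chi> i. r j (t $ i)))"
      by (simp add: \<phi>_def vec_eq_iff)
    then have "Q ** rdiag (\<phi> t) ** adj W = Q ** rdiag (\<chi> i. p (t $ i)) ** adj W
        + (\<Sum>j\<in>UNIV. (\<tau> j t - \<tau> j s) *\<^sub>R (Q ** rdiag (\<chi> i. r j (t $ i)) ** adj W))"
      by (simp only: linear_add[OF lin] linear_sum[OF lin] linear_scale[OF lin])
    also have "\<dots> = \<Phi> (Q ** rdiag t ** adj W)"
      unfolding \<Phi>_def tau[OF QW] P(1)[OF QW] R(1)[OF QW] X tau[OF UV] by simp
    finally show ?thesis by simp
  qed
  have phi_s: "\<phi> s = g s" by (simp add: \<phi>_def vec_eq_iff p)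
  have phi_deriv: "(\<phi> has_derivative (\<lambda>h. J *v h)) (at s)"
  proof (rule has_derivative_vecI)
    fix i
    have comp: "((\<lambda>t. f (t $ k)) has_derivative (\<lambda>h. f' (s $ k) * h $ k)) (at s)" if "odd_poly f f'" for f f' k
      using has_derivative_compose[OF bounded_linear_imp_has_derivative[OF bounded_linear_vec_nth]
          odd_poly_has_derivative[OF that, unfolded has_field_derivative_def]] .
    have nth: "((\<lambda>t. t $ k) has_derivative (\<lambda>h. h $ k)) (at s)" for k
      by (rule bounded_linear_imp_has_derivative[OF bounded_linear_vec_nth])
    have d\<tau>: "(\<tau> j has_derivative (\<lambda>h. \<Sum>k\<in>UNIV. I j k * h $ k)) (at s)" for j
    proof -
      have "(\<tau> j has_derivative (\<lambda>h. \<Sum>k\<in>UNIV. s $ k * (q' j (s $ k) * h $ k) + h $ k * q j (s $ k))) (at s)"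
        unfolding \<tau>_def by (intro has_derivative_sum has_derivative_mult nth comp q(1))
      then show ?thesis by (simp add: q mult.commute)
    qed
    have "((\<lambda>t. p (t $ i) + (\<Sum>j\<in>UNIV. (\<tau> j t - \<tau> j s) * r j (t $ i))) has_derivative
        (\<lambda>h. p' (s $ i) * h $ i + (\<Sum>j\<in>UNIV. (\<tau> j s - \<tau> j s) * (r' j (s $ i) * h $ i)
          + ((\<Sum>k\<in>UNIV. I j k * h $ k) - 0) * r j (s $ i)))) (at s)"
      by (intro has_derivative_add has_derivative_sum has_derivative_mult has_derivative_diff
          has_derivative_const comp p(1) r(1) d\<tau>)
    moreover have "p' (s $ i) * h $ i + (\<Sum>j\<in>UNIV. (\<tau> j s - \<tau> j s) * (r' j (s $ i) * h $ i)
          + ((\<Sum>k\<in>UNIV. I j k * h $ k) - 0) * r j (s $ i)) = (J *v h) $ i" for h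
    proof -
      have "p' (s $ i) * h $ i + (\<Sum>j\<in>UNIV. (\<tau> j s - \<tau> j s) * (r' j (s $ i) * h $ i)
          + ((\<Sum>k\<in>UNIV. I j k * h $ k) - 0) * r j (s $ i)) = eta g s $ i * h $ i + (\<Sum>k\<in>UNIV. C $ i $ k * h $ k)"
        by (simp add: p(3) r(2) IC)
      also have "\<dots> = (J *v h) $ i"
        by (simp add: C_nth left_diff_distrib sum_subtractf matrix_vector_mult_def
            if_distrib[of "\<lambda>u. u * _"] cong: if_cong)
      finally show ?thesis .
    qed
    ultimately show "((\<lambda>t. \<phi> t $ i) has_derivative (\<lambda>h. (J *v h) $ i)) (at s)"
      unfolding \<phi>_def by simp
  qed
  have "(g has_derivative (\<lambda>h. J *v h)) (at s)"
    unfolding J_def by (rule has_derivative_jacobian[OF sym])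
  from has_derivative_diff[OF this phi_deriv]
  have gap: "((\<lambda>t. g t - \<phi> t) has_derivative (\<lambda>h. 0)) (at s)" by simp
  have "((\<lambda>Y. G Y - \<Phi> Y) has_derivative (\<lambda>H. 0)) (at X)"
    unfolding has_derivative_at_alt
  proof (intro conjI allI impI bounded_linear_zero)
    fix e :: real assume "e > 0"
    then obtain d where d: "d > 0" "\<And>t. norm (t - s) < d \<Longrightarrow> norm (g t - \<phi> t) \<le> e * norm (t - s)"
      using gap unfolding has_derivative_at_alt by (auto simp: phi_s)
    obtain d' where d': "d' > 0" "\<And>Y. norm (Y - X) < d' \<Longrightarrow> Y \<in> N"
      using N unfolding open_dist dist_norm by blast
    have eq: "norm (G Y - \<Phi> Y) = norm (g (singular_values Y) - \<phi> (singular_values Y))" if "Y \<in> N" for Y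
    proof -
      have "singular_values Y \<in> D" using that D(2) by blast
      then obtain Q W where QW: "Q \<in> unitary_mats" "W \<in> unitary_mats"
        and Y: "Y = Q ** rdiag (singular_values Y) ** adj W"
        "spectral_operator g Y = Q ** rdiag (g (singular_values Y)) ** adj W"
        by (rule spectral_operator_svd[OF mn g])
      have "\<Phi> Y = Q ** rdiag (\<phi> (singular_values Y)) ** adj W"
        using Phi[OF QW, of "singular_values Y"] by (simp only: Y(1)[symmetric])
      then have "G Y - \<Phi> Y = Q ** (rdiag (g (singular_values Y)) - rdiag (\<phi> (singular_values Y))) ** adj W"
        unfolding G[OF that] Y(2)
        by (simp only: bounded_bilinear.diff_left[OF bounded_bilinear_matrix_mult]
            bounded_bilinear.diff_right[OF bounded_bilinear_matrix_mult])
      also have "\<dots> = Q ** rdiag (g (singular_values Y) - \<phi> (singular_values Y)) ** adj W"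
        by (simp only: linear_diff[OF linear_rdiag[OF mn]])
      finally show ?thesis by (simp only: norm_unitary[OF QW] norm_rdiag[OF mn])
    qed
    have zero: "G X - \<Phi> X = 0" using eq[OF N(2)] phi_s by (simp add: s_def)
    show "\<exists>d>0. \<forall>Y. norm (Y - X) < d \<longrightarrow> norm (G Y - \<Phi> Y - (G X - \<Phi> X) - 0) \<le> e * norm (Y - X)"
    proof (intro exI[of _ "min d d'"] conjI allI impI)
      fix Y assume Y: "norm (Y - X) < min d d'"
      have le: "norm (singular_values Y - s) \<le> norm (Y - X)"
        unfolding s_def by (rule singular_values_nonexpansive[OF mn])
      have "norm (G Y - \<Phi> Y) \<le> e * norm (singular_values Y - s)"
        using d(2)[of "singular_values Y"] eq[OF d'(2)[of Y]] le Y by simp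
      also have "\<dots> \<le> e * norm (Y - X)" using le \<open>e > 0\<close> by simp
      finally show "norm (G Y - \<Phi> Y - (G X - \<Phi> X) - 0) \<le> e * norm (Y - X)" by (simp add: zero)
    qed (use d(1) d'(1) in simp)
  qed
  moreover have "(\<Phi> has_derivative ?DG) (at X)"
  proof -
    have "((\<lambda>Y. P Y + (\<Sum>j\<in>UNIV. (Y \<bullet> T j Y - X \<bullet> T j X) *\<^sub>R R j Y)) has_derivative
       (\<lambda>H. U ** spectral_derivative p p' s (adj U ** H ** V) ** adj V
         + (\<Sum>j\<in>UNIV. (X \<bullet> T j X - X \<bullet> T j X) *\<^sub>R (U ** spectral_derivative (r j) (r' j) s (adj U ** H ** V) ** adj V)
           + (X \<bullet> (U ** spectral_derivative (q j) (q' j) s (adj U ** H ** V) ** adj V) + H \<bullet> T j X - 0) *\<^sub>R R j X))) (at X)"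
      by (intro has_derivative_add has_derivative_sum has_derivative_scaleR has_derivative_diff
          has_derivative_inner has_derivative_const has_derivative_ident P(2)[OF UV, of s, folded X] R(2) T(2))
    moreover have "U ** spectral_derivative p p' s (adj U ** H ** V) ** adj V
         + (\<Sum>j\<in>UNIV. (X \<bullet> T j X - X \<bullet> T j X) *\<^sub>R (U ** spectral_derivative (r j) (r' j) s (adj U ** H ** V) ** adj V)
           + (X \<bullet> (U ** spectral_derivative (q j) (q' j) s (adj U ** H ** V) ** adj V) + H \<bullet> T j X - 0) *\<^sub>R R j X) =
       ?DG H" (is "?l = ?r") for H
    proof -
      define K where "K = adj U ** H ** V"
      have H: "H = U ** K ** adj V"
        by (simp add: K_def matrix_mul_assoc[symmetric] unitary_matsD[OF UV(1)] unitary_matsD[OF UV(2)])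
      define \<kappa> where "\<kappa> k = 1 \<bullet> K $ k $ lead k" for k
      \<comment> \<open>Only \<open>E\<^sub>1\<close> acts on the real parts of the diagonal, and its diagonal is zero because \<open>q' j\<close> vanishes
        at the entries of \<open>s\<close>.\<close>
      have XT: "X \<bullet> (U ** spectral_derivative (q j) (q' j) s K ** adj V) = 0" for j
      proof -
        have "1 \<bullet> spectral_derivative (q j) (q' j) s K $ k $ lead k = 0" for k
        proof -
          have "1 \<bullet> conjugate (K $ k $ lead k) = 1 \<bullet> K $ k $ lead k"
            using inner_conjugate_conjugate[of 1 "K $ k $ lead k"] by simp
          moreover have "divided_difference (q j) (q' j) (s $ k) (s $ k) = 0" by (simp add: divided_difference_def q(3))
          ultimately show ?thesis by (simp add: spectral_derivative_nth[OF mn] inner_add_right inner_diff_right)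
        qed
        then show ?thesis unfolding X inner_unitary[OF UV] by (simp add: inner_rdiag[OF mn])
      qed
      have HT: "H \<bullet> T j X = (\<Sum>k\<in>UNIV. I j k * \<kappa> k)" for j
        unfolding X T(1)[OF UV] unfolding H inner_unitary[OF UV]
        by (subst inner_commute) (simp add: inner_rdiag[OF mn] q(2) \<kappa>_def)
      have lin: "linear (\<lambda>x. U ** rdiag x ** adj V :: 'a^'n::_^'m::_)"
        unfolding linear_conv_bounded_linear
        by (intro bounded_linear_compose[OF bounded_linear_matrix_mult_left]
            bounded_linear_compose[OF bounded_linear_matrix_mult_right] bounded_linear_rdiag[OF mn])
      have RX: "R j X = U ** rdiag (\<chi> i. C $ i $ j) ** adj V" for j
        unfolding X R(1)[OF UV] by (simp add: r(2))
      have "(\<Sum>j\<in>UNIV. (\<Sum>k\<in>UNIV. I j k * \<kappa> k) *\<^sub>R R j X) =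
          U ** rdiag (\<Sum>j\<in>UNIV. (\<Sum>k\<in>UNIV. I j k * \<kappa> k) *\<^sub>R (\<chi> i. C $ i $ j)) ** adj V"
        unfolding RX by (simp only: linear_sum[OF lin] linear_scale[OF lin])
      also have "(\<Sum>j\<in>UNIV. (\<Sum>k\<in>UNIV. I j k * \<kappa> k) *\<^sub>R (\<chi> i. C $ i $ j)) = (\<chi> i. \<Sum>k\<in>UNIV. C $ i $ k * \<kappa> k)"
        by (simp add: vec_eq_iff IC)
      finally have "?l = U ** spectral_derivative p p' s K ** adj V + U ** rdiag (\<chi> i. \<Sum>k\<in>UNIV. C $ i $ k * \<kappa> k) ** adj V"
        unfolding K_def[symmetric] XT HT by simp
      also have "\<dots> = U ** (spectral_derivative p p' s K + rdiag (\<chi> i. \<Sum>k\<in>UNIV. C $ i $ k * \<kappa> k)) ** adj V"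
        by (simp only: bounded_bilinear.add_left[OF bounded_bilinear_matrix_mult]
            bounded_bilinear.add_right[OF bounded_bilinear_matrix_mult])
      also have "\<dots> = ?r"
        unfolding Let_def K_def C_def \<kappa>_def
        by (subst spectral_derivative_formula[OF mn V s0 p eta_zero[OF sym]]) simp_all
      finally show ?thesis .
    qed
    ultimately show ?thesis unfolding \<Phi>_def by simp
  qed
  ultimately have "((\<lambda>Y. (G Y - \<Phi> Y) + \<Phi> Y) has_derivative (\<lambda>H. 0 + ?DG H)) (at X)"
    by (rule has_derivative_add)
  then show ?thesis by simp
qed

text \<open>Near \<open>s\<close> the function \<open>g\<close> is \<open>G\<close> between two linear maps: \<open>x \<mapsto> U D\<^sub>x V\<^sup>*\<close> and the real part of the diagonal
  of \<open>U\<^sup>* M V\<close>.\<close>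

lemma differentiable_of_spectral_operator:
  fixes X :: "'a::real_or_complex^'n::{finite,linorder}^'m::{finite,linorder}"
    and g :: "real^'m::_ \<Rightarrow> real^'m::_" and G :: "'a^'n::_^'m::_ \<Rightarrow> 'a^'n::_^'m::_"
  assumes mn: "CARD('m) \<le> CARD('n)" and N: "open N" "X \<in> N" and D: "singular_values ` N \<subseteq> D"
    and g: "absolutely_symmetric_on D g" and G: "\<And>Y. Y \<in> N \<Longrightarrow> G Y = spectral_operator g Y"
    and UV: "U \<in> unitary_mats" "V \<in> unitary_mats" and X: "X = U ** rdiag s ** adj V"
    and diff: "G differentiable (at X)"
  shows "g differentiable (at s)"
proof -
  have lin: "bounded_linear (\<lambda>x. U ** rdiag x ** adj V :: 'a^'n::_^'m::_)"
    by (intro bounded_linear_compose[OF bounded_linear_matrix_mult_left]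
        bounded_linear_compose[OF bounded_linear_matrix_mult_right] bounded_linear_rdiag[OF mn])
  have lin': "bounded_linear (\<lambda>M :: 'a^'n::_^'m::_. \<chi> i. 1 \<bullet> (adj U ** M ** V) $ i $ lead i)"
    unfolding linear_conv_bounded_linear[symmetric]
    by (rule linearI)
      (simp_all add: vec_eq_iff bounded_bilinear.add_left[OF bounded_bilinear_matrix_mult]
        bounded_bilinear.add_right[OF bounded_bilinear_matrix_mult]
        bounded_bilinear.scaleR_left[OF bounded_bilinear_matrix_mult]
        bounded_bilinear.scaleR_right[OF bounded_bilinear_matrix_mult] inner_add_right)
  obtain G' where G': "(G has_derivative G') (at X)" using diff unfolding differentiable_def by blast
  have "((\<lambda>x. \<chi> i. 1 \<bullet> (adj U ** G (U ** rdiag x ** adj V) ** V) $ i $ lead i) has_derivative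
      (\<lambda>h. \<chi> i. 1 \<bullet> (adj U ** G' (U ** rdiag h ** adj V) ** V) $ i $ lead i)) (at s)"
    by (rule bounded_linear.has_derivative[OF lin'
          has_derivative_compose[OF bounded_linear_imp_has_derivative[OF lin]]]) (simp only: X[symmetric] G')
  then have "(g has_derivative
      (\<lambda>h. \<chi> i. 1 \<bullet> (adj U ** G' (U ** rdiag h ** adj V) ** V) $ i $ lead i)) (at s)"
  proof (rule has_derivative_transform_within_open)
    show "open ((\<lambda>x. U ** rdiag x ** adj V) -` N)"
      by (intro open_vimage N linear_continuous_on lin)
    show "s \<in> (\<lambda>x. U ** rdiag x ** adj V) -` N" using N(2) X by simp
    fix x assume "x \<in> (\<lambda>x. U ** rdiag x ** adj V) -` N"
    then have x: "U ** rdiag x ** adj V \<in> N" by simp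
    have "G (U ** rdiag x ** adj V) = U ** rdiag (g x) ** adj V"
      unfolding G[OF x] by (rule spectral_operator_rdiag[OF mn g UV]) (use x D in blast)
    then have "adj U ** G (U ** rdiag x ** adj V) ** V = rdiag (g x)"
      by (simp add: matrix_mul_assoc[symmetric] unitary_matsD[OF UV(1)] unitary_matsD[OF UV(2)])
    then show "(\<chi> i. 1 \<bullet> (adj U ** G (U ** rdiag x ** adj V) ** V) $ i $ lead i) = g x"
      by (simp add: vec_eq_iff rdiag_nth[OF mn] of_real_def)
  qed
  then show ?thesis unfolding differentiable_def by blast
qed

theorem theorem3p3:
  fixes N :: "('a::real_or_complex^'n::{finite,linorder}^'m::{finite,linorder}) set"
    and g :: "real^'m::_ \<Rightarrow> real^'m::_"
    and D :: "(real^'m::_) set"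
    and G :: "'a^'n::_^'m::_ \<Rightarrow> 'a^'n::_^'m::_"
    and X :: "'a^'n::_^'m::_"
    and U :: "'a^'m::_^'m::_" and V :: "'a^'n::_^'n::_" and V1 :: "'a^'m::_^'n::_" and V2 :: "'a^'n::_^'n::_"
  assumes "CARD('m) \<le> CARD('n)"
    and "open N" and "N \<noteq> {}"
    and "open D" and "singular_values ` N \<subseteq> D"
    and "absolutely_symmetric_on D g"
    and "\<And>Y. Y \<in> N \<Longrightarrow> G Y = spectral_operator g Y"
    and "X \<in> N"
    and "U \<in> unitary_mats" and "V \<in> unitary_mats"
    and "X = U ** blocks (real_Diag (singular_values X)) 0 ** adj V"
    and "V = blocks V1 V2"
  shows "(G differentiable (at X) \<longleftrightarrow> g differentiable (at (singular_values X))) \<and>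
    (G differentiable (at X) \<longrightarrow>
      (G has_derivative
        (\<lambda>H. let s = singular_values X;
                 A = adj U ** H ** V1;
                 B = adj U ** H ** V2
             in U ** blocks
                  (E1_mat g s \<odot> S_part A
                   + Diag_mat (map_matrix of_real (C_mat g s) *v diag_vec (S_part A))
                   + E2_mat g s \<odot> T_part A)
                  (F_mat g s \<odot> B)
                ** adj V)) (at X))"
proof -
  have 1: "g differentiable (at (singular_values X))" if "G differentiable (at X)"
    by (rule differentiable_of_spectral_operator[where N = N and D = D]) (fact assms that)+
  have 2: "(G has_derivative (\<lambda>H. let A = adj U ** H ** V1; B = adj U ** H ** V2
      in U ** blocks (E1_mat g (singular_values X) \<odot> S_part A
                   + Diag_mat (map_matrix of_real (C_mat g (singular_values X)) *v diag_vec (S_part A))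
                   + E2_mat g (singular_values X) \<odot> T_part A) (F_mat g (singular_values X) \<odot> B) ** adj V)) (at X)"
    if "g differentiable (at (singular_values X))"
    by (rule spectral_operator_has_derivative[where N = N and D = D]) (fact assms that)+
  have 3: "G differentiable (at X)" if "g differentiable (at (singular_values X))"
    using 2[OF that] unfolding differentiable_def by blast
  show ?thesis using 1 2 3 unfolding Let_def by blast
qed

end
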